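(* Let ${\bf g}$ be one of the symmetric Lie algebras $u(n)$, $u(k,n-k)$ or $gl(n,\mathbb R)$ with index $k$ ($n\ge2$, $1\le k<n$), let $G$ be the corresponding Lie group $U(n)$, $U(k,n-k)$ or $GL(n,\mathbb R)$, and let $\alpha,\beta,\gamma\in\mathbb R$. The moving equation $$\widetilde\gamma_t=-\alpha[\widetilde\gamma_x,\widetilde\gamma_{xx}]+\beta\Big([\widetilde\gamma_x,\widetilde\gamma_{xxxx}]-[\widetilde\gamma_{xx},\widetilde\gamma_{xxx}]\Big)+(4\gamma-2\beta)\big[\widetilde\gamma_x,\;\widetilde\gamma_{xx}\widetilde\gamma_x^{-1}\widetilde\gamma_{xx}\widetilde\gamma_x^{-1}\widetilde\gamma_{xx}\big]\qquad(1)$$ for ${\bf g}$-valued functions $\widetilde\gamma=\widetilde\gamma(t,x)$ with $\widetilde\gamma_x\in\{E^{-1}\sigma_3E: E\in G\}$ is equivalent to the equation $$\varphi_t=\Big[\varphi,\;-\alpha\varphi_{xx}+\beta\varphi_{xxxx}+(4\gamma-2\beta)\big(\varphi_x\varphi^{-1}\varphi_x\varphi^{-1}\varphi_x\big)_x\Big]\qquad(2)$$ for functions $\varphi=\varphi(t,x)$ with values in $\{E^{-1}\sigma_3E: E\in G\}$, through the correspondence $\varphi=\widetilde\gamma_x$: if $\widetilde\gamma$ satisfies (1) with $\widetilde\gamma_x\in\{E^{-1}\sigma_3E:E\in G\}$, then $\varphi=\widetilde\gamma_x$ satisfies (2); and conversely every solution $\varphi$ of (2) is of the form $\varphi=\widetilde\gamma_x$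 for some solution $\widetilde\gamma$ of (1).
   Context: All functions are smooth functions of $(t,x)\in[0,T)\times\mathbb R$; $[\cdot,\cdot]$ is the matrix commutator. For ${\bf g}=u(n)$ or $u(k,n-k)$, $\sigma_3=\frac{\sqrt{-1}}{2}\begin{pmatrix} I_k&0\\0&-I_{n-k}\end{pmatrix}$; for ${\bf g}=gl(n,\mathbb R)$, $\sigma_3=\frac12\begin{pmatrix} I_k&0\\0&-I_{n-k}\end{pmatrix}$. $U(k,n-k)$ is the group of complex matrices $E$ with $E^*I_{k,n-k}E=I_{k,n-k}$, $I_{k,n-k}=\mathrm{diag}(I_k,-I_{n-k})$, and $u(k,n-k)$ is its Lie algebra. *)

theory Defs
  imports "HOL-Analysis.Analysis"
begin

section \<open>Smooth functions of \<open>(t, x)\<close>\<close>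

text \<open>
  The end point \<open>T\<close> is an extended real, so that \<open>[0, \<infinity>)\<close> is covered as well.
\<close>

definition time_interval :: "ereal \<Rightarrow> real set"
  where "time_interval T = {t. 0 \<le> t \<and> ereal t < T}"

text \<open>
  The time derivative is taken within the time interval \<open>I\<close>; at \<open>t = 0\<close> it is one-sided.
\<close>

definition dt :: "real set \<Rightarrow> (real \<Rightarrow> real \<Rightarrow> 'v::real_normed_vector) \<Rightarrow> real \<Rightarrow> real \<Rightarrow> 'v"
  where "dt I f t x = vector_derivative (\<lambda>s. f s x) (at t within I)"

definition dx :: "(real \<Rightarrow> real \<Rightarrow> 'v::real_normed_vector) \<Rightarrow> real \<Rightarrow> real \<Rightarrow> 'v"
  where "dx f t x = vector_derivative (\<lambda>y. f t y) (at x)"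

text \<open>
  All mixed partial derivatives up to order \<open>m\<close>, in any order of differentiation, exist and are
  continuous on \<open>I \<times> \<real>\<close>. Nothing is required outside \<open>I \<times> \<real>\<close>.
\<close>

primrec C_k_on :: "nat \<Rightarrow> real set \<Rightarrow> (real \<Rightarrow> real \<Rightarrow> 'v::real_normed_vector) \<Rightarrow> bool"
  where
    "C_k_on 0 I f \<longleftrightarrow> continuous_on (I \<times> UNIV) (\<lambda>(t, x). f t x)"
  | "C_k_on (Suc m) I f \<longleftrightarrow>
       continuous_on (I \<times> UNIV) (\<lambda>(t, x). f t x) \<and>
       (\<forall>t\<in>I. \<forall>x. (\<lambda>s. f s x) differentiable (at t within I)) \<and>
       (\<forall>t\<in>I. \<forall>x. (\<lambda>y. f t y) differentiable (at x)) \<and>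
       C_k_on m I (dt I f) \<and> C_k_on m I (dx f)"

definition smooth_on_strip :: "real set \<Rightarrow> (real \<Rightarrow> real \<Rightarrow> 'v::real_normed_vector) \<Rightarrow> bool"
  where "smooth_on_strip I f \<longleftrightarrow> (\<forall>m. C_k_on m I f)"


section \<open>The groups, their Lie algebras and \<open>\<sigma>\<^sub>3\<close>\<close>

definition commutator :: "'a::ring_1^'n^'n \<Rightarrow> 'a^'n^'n \<Rightarrow> 'a^'n^'n"
  where "commutator A B = A ** B - B ** A"

definition conj_transpose :: "complex^'n^'m \<Rightarrow> complex^'m^'n"
  where "conj_transpose A = (\<chi> i j. cnj (A $ j $ i))"

text \<open>
  The matrix \<open>diag(I\<^sub>k, -I\<^bsub>n-k\<^esub>)\<close> with \<open>n = CARD('n)\<close>. The index type is ordered, and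
  \<open>card {l. l < i}\<close> is the zero-based position of the index \<open>i\<close>.
\<close>

definition signature_matrix :: "nat \<Rightarrow> 'a::ring_1^'n::{finite,wellorder}^'n::{finite,wellorder}"
  where "signature_matrix k =
    (\<chi> i j. if i \<noteq> j then 0 else if card {l. l < i} < k then 1 else - 1)"

definition sigma3_complex :: "nat \<Rightarrow> complex^'n::{finite,wellorder}^'n::{finite,wellorder}"
  where "sigma3_complex k = mat (\<i> / 2) ** signature_matrix k"

definition sigma3_real :: "nat \<Rightarrow> real^'n::{finite,wellorder}^'n::{finite,wellorder}"
  where "sigma3_real k = mat (1 / 2) ** signature_matrix k"

definition unitary_group :: "(complex^'n^'n) set"
  where "unitary_group = {E. conj_transpose E ** E = mat 1}"

definition pseudo_unitary_group :: "nat \<Rightarrow> (complex^'n::{finite,wellorder}^'n::{finite,wellorder}) set"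
  where "pseudo_unitary_group k =
    {E. conj_transpose E ** signature_matrix k ** E = signature_matrix k}"

definition general_linear_group :: "(real^'n^'n) set"
  where "general_linear_group = {E. invertible E}"

text \<open>
  The Lie algebra of a matrix group is its tangent space at the identity: the velocities at the
  identity of curves in the group. The usual linear descriptions of the three Lie algebras are
  the lemmas \<open>lie_algebra_unitary\<close>, \<open>lie_algebra_pseudo_unitary\<close> and
  \<open>lie_algebra_general_linear\<close> below.
\<close>

definition lie_algebra :: "('a::real_normed_field^'n^'n) set \<Rightarrow> ('a^'n^'n) set"
  where "lie_algebra G =
    {X. \<exists>c::real \<Rightarrow> 'a^'n^'n. (\<forall>s. c s \<in> G) \<and> c 0 = mat 1 \<and> (c has_vector_derivative X) (at 0)}"

definition orbit :: "('a::semiring_1^'n^'n) set \<Rightarrow> 'a^'n^'n \<Rightarrow> ('a^'n^'n) set"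
  where "orbit G A = {matrix_inv E ** A ** E | E. E \<in> G}"


section \<open>The two equations\<close>

text \<open>
  \<open>G\<close> is the group, \<open>A\<close> the base point (\<open>\<sigma>\<^sub>3\<close>) of the orbit, \<open>u\<close> the unknown function.
\<close>

definition moving_solution ::
  "ereal \<Rightarrow> real \<Rightarrow> real \<Rightarrow> real \<Rightarrow> ('a::real_normed_field^'n^'n) set \<Rightarrow> 'a^'n^'n
    \<Rightarrow> (real \<Rightarrow> real \<Rightarrow> 'a^'n^'n) \<Rightarrow> bool"
  where "moving_solution T \<alpha> \<beta> \<gamma> G A u \<longleftrightarrow>
    smooth_on_strip (time_interval T) u \<and>
    (\<forall>t\<in>time_interval T. \<forall>x. u t x \<in> lie_algebra G \<and> dx u t x \<in> orbit G A) \<and>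
    (\<forall>t\<in>time_interval T. \<forall>x.
       let ux = dx u t x; uxx = (dx ^^ 2) u t x; uxxx = (dx ^^ 3) u t x; uxxxx = (dx ^^ 4) u t x
       in dt (time_interval T) u t x =
            - \<alpha> *\<^sub>R commutator ux uxx
            + \<beta> *\<^sub>R (commutator ux uxxxx - commutator uxx uxxx)
            + (4 * \<gamma> - 2 * \<beta>) *\<^sub>R
                commutator ux (uxx ** matrix_inv ux ** uxx ** matrix_inv ux ** uxx))"

definition orbit_solution ::
  "ereal \<Rightarrow> real \<Rightarrow> real \<Rightarrow> real \<Rightarrow> ('a::real_normed_field^'n^'n) set \<Rightarrow> 'a^'n^'n
    \<Rightarrow> (real \<Rightarrow> real \<Rightarrow> 'a^'n^'n) \<Rightarrow> bool"
  where "orbit_solution T \<alpha> \<beta> \<gamma> G A \<phi> \<longleftrightarrow>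
    smooth_on_strip (time_interval T) \<phi> \<and>
    (\<forall>t\<in>time_interval T. \<forall>x. \<phi> t x \<in> orbit G A) \<and>
    (\<forall>t\<in>time_interval T. \<forall>x.
       dt (time_interval T) \<phi> t x =
         commutator (\<phi> t x)
           (- \<alpha> *\<^sub>R (dx ^^ 2) \<phi> t x
            + \<beta> *\<^sub>R (dx ^^ 4) \<phi> t x
            + (4 * \<gamma> - 2 * \<beta>) *\<^sub>R
                dx (\<lambda>s y. dx \<phi> s y ** matrix_inv (\<phi> s y) ** dx \<phi> s y
                          ** matrix_inv (\<phi> s y) ** dx \<phi> s y) t x))"


section \<open>Linear descriptions of the Lie algebras\<close>

lemma bounded_bilinear_matrix_mult:
  "bounded_bilinear ((**) :: ('a::{real_normed_field,euclidean_space}^'n^'n) \<Rightarrow> 'a^'n^'n \<Rightarrow> 'a^'n^'n)"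
proof -
  have "bilinear ((**) :: ('a^'n^'n) \<Rightarrow> 'a^'n^'n \<Rightarrow> 'a^'n^'n)"
    unfolding bilinear_def
    by (auto intro!: linearI simp: matrix_add_ldistrib vec_eq_iff matrix_matrix_mult_def
        sum.distrib distrib_left distrib_right scaleR_sum_right)
  then show ?thesis
    by (simp add: bilinear_conv_bounded_bilinear)
qed

lemma bounded_linear_conj_transpose:
  "bounded_linear (conj_transpose :: complex^'n^'n \<Rightarrow> complex^'n^'n)"
  unfolding linear_conv_bounded_linear[symmetric]
  by (rule linearI) (auto simp: conj_transpose_def vec_eq_iff)

lemma conj_transpose_mult: "conj_transpose (A ** B) = conj_transpose B ** conj_transpose A"
  by (simp add: conj_transpose_def matrix_matrix_mult_def vec_eq_iff mult.commute)

lemma conj_transpose_mat_1 [simp]: "conj_transpose (mat 1 :: complex^'n^'n) = mat 1"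
  by (auto simp: conj_transpose_def mat_def vec_eq_iff)

lemma eventually_invertible:
  fixes X :: "'a::{real_normed_field,euclidean_space}^'n^'n"
  shows "\<forall>\<^sub>F s in at (0::real). invertible (mat 1 + s *\<^sub>R X)"
proof -
  have "isCont (\<lambda>s. det (mat 1 + s *\<^sub>R X)) 0"
    unfolding det_def by (intro continuous_intros)
  then have "((\<lambda>s. det (mat 1 + s *\<^sub>R X)) \<longlongrightarrow> 1) (at 0)"
    unfolding isCont_def by simp
  then have "\<forall>\<^sub>F s in at 0. det (mat 1 + s *\<^sub>R X) \<noteq> 0"
    by (rule tendsto_imp_eventually_ne) simp
  then show ?thesis by (simp add: invertible_det_nz)
qed

lemma matrix_inv_right: "invertible A \<Longrightarrow> A ** matrix_inv A = mat 1"
  and matrix_inv_left: "invertible A \<Longrightarrow> matrix_inv A ** A = mat 1"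
  for A :: "'a::semiring_1^'n^'n"
  unfolding invertible_def matrix_inv_def by (metis (mono_tags, lifting) someI_ex)+

lemma cayley_velocity:
  fixes X :: "'a::{real_normed_field,euclidean_space}^'n^'n" and c :: "real \<Rightarrow> 'a^'n^'n"
  assumes c: "\<forall>\<^sub>F s in at 0. c s ** (mat 1 - (s / 2) *\<^sub>R X) = mat 1 + (s / 2) *\<^sub>R X"
    and c0: "c 0 = mat 1"
  shows "(c has_vector_derivative X) (at 0)"
proof -
  interpret mm: bounded_bilinear "(**) :: ('a^'n^'n) \<Rightarrow> 'a^'n^'n \<Rightarrow> 'a^'n^'n"
    by (rule bounded_bilinear_matrix_mult)
  obtain K where K: "K > 0" "\<And>A B. norm ((A::'a^'n^'n) ** (B::'a^'n^'n)) \<le> norm A * norm B * K"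
    using mm.pos_bounded by blast
  define C where "C = norm X * K"
  have C: "C \<ge> 0" using K(1) by (simp add: C_def)
  have small: "\<forall>\<^sub>F s in at (0::real). \<bar>s\<bar> * C < 1"
  proof -
    have "((\<lambda>s::real. \<bar>s\<bar> * C) \<longlongrightarrow> \<bar>0\<bar> * C) (at 0)" by (intro tendsto_intros)
    then show ?thesis using order_tendstoD(2)[of _ "\<bar>0\<bar> * C" "at 0" 1] by simp
  qed
  have est: "\<forall>\<^sub>F s in at 0. norm ((c (0 + s) - c 0) /\<^sub>R s - X) \<le> \<bar>s\<bar> * (norm X * C)"
    using c small eventually_neq_at_within[of 0 0 UNIV]
  proof eventually_elim
    case (elim s)
    define d where "d = c s - mat 1"
    have cs: "c s = d + mat 1" by (simp add: d_def)
    have "d + mat 1 - ((s / 2) *\<^sub>R (d ** X) + (s / 2) *\<^sub>R X) = mat 1 + (s / 2) *\<^sub>R X"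
      using elim(1) unfolding cs
      by (simp add: mm.diff_right mm.add_left mm.scaleR_right scaleR_add_right)
    then have "d = (s / 2) *\<^sub>R (d ** X) + ((s / 2) *\<^sub>R X + (s / 2) *\<^sub>R X)"
      by (simp add: algebra_simps)
    also have "(s / 2) *\<^sub>R X + (s / 2) *\<^sub>R X = s *\<^sub>R X"
      by (simp flip: scaleR_add_left)
    finally have d: "d = (s / 2) *\<^sub>R (d ** X) + s *\<^sub>R X" .
    have dX: "norm (d ** X) \<le> norm d * C"
      using K(2)[of d X] by (simp add: C_def mult.assoc)
    have "norm d \<le> norm ((s / 2) *\<^sub>R (d ** X)) + norm (s *\<^sub>R X)"
      using norm_triangle_ineq[of "(s / 2) *\<^sub>R (d ** X)" "s *\<^sub>R X"] d by simp
    also have "norm ((s / 2) *\<^sub>R (d ** X)) \<le> \<bar>s\<bar> / 2 * (norm d * C)"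
      using dX by (simp add: mult_left_mono)
    also have "\<bar>s\<bar> / 2 * (norm d * C) = norm d / 2 * (\<bar>s\<bar> * C)" by simp
    also have "\<dots> \<le> norm d / 2 * 1"
      using elim(2) by (intro mult_left_mono) auto
    finally have nd: "norm d \<le> 2 * (\<bar>s\<bar> * norm X)" by simp
    have "d /\<^sub>R s = (1 / 2) *\<^sub>R (d ** X) + X"
      using elim(3) by (subst d) (simp add: scaleR_add_right)
    then have "norm (d /\<^sub>R s - X) = norm (d ** X) / 2" by simp
    also have "\<dots> \<le> (2 * (\<bar>s\<bar> * norm X)) * C / 2"
      using dX mult_right_mono[OF nd C] by linarith
    finally show ?case by (simp add: d_def c0 mult.assoc)
  qed
  have "((\<lambda>s::real. \<bar>s\<bar> * (norm X * C)) \<longlongrightarrow> \<bar>0\<bar> * (norm X * C)) (at 0)"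
    by (intro tendsto_intros)
  then have "((\<lambda>s. (c (0 + s) - c 0) /\<^sub>R s - X) \<longlongrightarrow> 0) (at 0)"
    using est by (intro Lim_null_comparison[OF est]) simp
  then have lim: "((\<lambda>s. (c (0 + s) - c 0) /\<^sub>R s) \<longlongrightarrow> X) (at 0)"
    using Lim_null by blast
  have "((\<lambda>s. norm ((c (0 + s) - c 0) /\<^sub>R s - X)) \<longlongrightarrow> 0) (at 0)"
    using lim by (simp add: LIM_zero tendsto_norm_zero)
  moreover have "\<forall>\<^sub>F s in at 0. norm ((c (0 + s) - c 0) /\<^sub>R s - X) =
      norm (c (0 + s) - c 0 - s *\<^sub>R X) / norm s"
    using eventually_neq_at_within[of 0 0 UNIV]
  proof eventually_elim
    case (elim s)
    have "c (0 + s) - c 0 - s *\<^sub>R X = s *\<^sub>R ((c (0 + s) - c 0) /\<^sub>R s - X)"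
      using elim by (simp add: scaleR_diff_right)
    then show ?case using elim by simp
  qed
  ultimately have "((\<lambda>s. norm (c (0 + s) - c 0 - s *\<^sub>R X) / norm s) \<longlongrightarrow> 0) (at 0)"
    using tendsto_cong by force
  then show ?thesis
    unfolding has_vector_derivative_def has_derivative_at
    by (simp add: bounded_linear_scaleR_left)
qed

lemma lie_algebra_form:
  fixes J :: "complex^'n^'n"
  shows "lie_algebra {E. conj_transpose E ** J ** E = J} = {X. conj_transpose X ** J + J ** X = 0}"
    (is "lie_algebra ?G = ?g")
proof (intro equalityI subsetI)
  interpret mm: bounded_bilinear "(**) :: (complex^'n^'n) \<Rightarrow> complex^'n^'n \<Rightarrow> complex^'n^'n"
    by (rule bounded_bilinear_matrix_mult)
  interpret ct: bounded_linear "conj_transpose :: complex^'n^'n \<Rightarrow> complex^'n^'n"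
    by (rule bounded_linear_conj_transpose)
  {
    fix X assume "X \<in> lie_algebra ?G"
    then obtain c where c: "\<And>s. conj_transpose (c s) ** J ** c s = J" "c 0 = mat 1"
        "(c has_vector_derivative X) (at 0)"
      by (auto simp: lie_algebra_def)
    have "((\<lambda>s. conj_transpose (c s)) has_vector_derivative conj_transpose X) (at 0)"
      by (rule ct.has_vector_derivative[OF c(3)])
    then have "((\<lambda>s. conj_transpose (c s) ** J) has_vector_derivative conj_transpose X ** J) (at 0)"
      by (rule bounded_linear.has_vector_derivative[OF mm.bounded_linear_left])
    from mm.has_vector_derivative[OF this c(3)]
    have "((\<lambda>s. J) has_vector_derivative (conj_transpose (c 0) ** J ** X + conj_transpose X ** J ** c 0)) (at 0)"
      by (simp add: c(1))
    then have "conj_transpose (c 0) ** J ** X + conj_transpose X ** J ** c 0 = 0"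
      using has_vector_derivative_const vector_derivative_unique_at by blast
    then show "X \<in> ?g" by (simp add: c(2) add.commute)
  }
  fix X assume "X \<in> ?g"
  then have X: "conj_transpose X ** J = - (J ** X)"
    by (simp add: eq_neg_iff_add_eq_0)
  define P where "P s = mat 1 + (s / 2) *\<^sub>R X" for s :: real
  define M where "M s = mat 1 - (s / 2) *\<^sub>R X" for s :: real
  define c where "c s = (if invertible (M s) then P s ** matrix_inv (M s) else mat 1)" for s
  have PJ: "conj_transpose (P s) ** J = J ** M s" for s
    by (simp add: P_def M_def ct.add ct.scaleR mm.add_left mm.diff_right mm.scaleR_left
        mm.scaleR_right X)
  have MJ: "conj_transpose (M s) ** J = J ** P s" for s
    by (simp add: P_def M_def ct.diff ct.scaleR mm.diff_left mm.add_right mm.scaleR_left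
        mm.scaleR_right X)
  have comm: "M s ** P s = P s ** M s" for s
    by (simp add: P_def M_def mm.add_left mm.add_right mm.diff_left mm.diff_right)
  have mem: "c s \<in> ?G" for s
  proof (cases "invertible (M s)")
    case True
    have "conj_transpose (c s) ** J ** c s =
        conj_transpose (matrix_inv (M s)) ** (conj_transpose (P s) ** J) ** P s ** matrix_inv (M s)"
      using True by (simp add: c_def conj_transpose_mult matrix_mul_assoc)
    also have "\<dots> = conj_transpose (matrix_inv (M s)) ** J ** (M s ** P s) ** matrix_inv (M s)"
      by (simp add: PJ matrix_mul_assoc)
    also have "\<dots> = conj_transpose (matrix_inv (M s)) ** (J ** P s) ** (M s ** matrix_inv (M s))"
      unfolding comm by (simp add: matrix_mul_assoc)
    also have "\<dots> = conj_transpose (matrix_inv (M s)) ** (J ** P s)"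
      by (simp add: matrix_inv_right[OF True])
    also have "\<dots> = conj_transpose (M s ** matrix_inv (M s)) ** J"
      by (simp only: conj_transpose_mult MJ[symmetric] matrix_mul_assoc)
    also have "\<dots> = J" using True by (simp add: matrix_inv_right)
    finally show ?thesis by simp
  next
    case False
    then show ?thesis by (simp add: c_def)
  qed
  have "\<forall>\<^sub>F s in at (0::real). c s ** M s = P s"
    using eventually_invertible[of "- ((1 / 2) *\<^sub>R X)"]
  proof eventually_elim
    case (elim s)
    then have "invertible (M s)" by (simp add: M_def)
    then show ?case by (simp add: c_def matrix_inv_left flip: matrix_mul_assoc)
  qed
  moreover have c0: "c 0 = mat 1"
  proof -
    have "M 0 = mat 1" "P 0 = mat 1" by (simp_all add: M_def P_def)
    then show ?thesis using matrix_inv_right[of "M 0"] by (simp add: c_def)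
  qed
  ultimately have "(c has_vector_derivative X) (at 0)"
    by (intro cayley_velocity) (simp_all add: M_def P_def)
  then show "X \<in> lie_algebra ?G"
    using mem c0 unfolding lie_algebra_def by blast
qed

lemma lie_algebra_unitary:
  "lie_algebra (unitary_group :: (complex^'n^'n) set) = {X. conj_transpose X + X = 0}"
  using lie_algebra_form[of "mat 1 :: complex^'n^'n"] by (simp add: unitary_group_def)

lemma lie_algebra_pseudo_unitary:
  "lie_algebra (pseudo_unitary_group k) =
    {X. conj_transpose X ** signature_matrix k + signature_matrix k ** X = 0}"
  unfolding pseudo_unitary_group_def by (rule lie_algebra_form)

lemma lie_algebra_general_linear:
  "lie_algebra (general_linear_group :: (real^'n^'n) set) = UNIV"
proof (intro set_eqI iffI UNIV_I)
  fix X :: "real^'n^'n"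
  define c where "c s = (if invertible (mat 1 + s *\<^sub>R X) then mat 1 + s *\<^sub>R X else mat 1)" for s :: real
  have inv1: "invertible (mat 1 :: real^'n^'n)"
    unfolding invertible_def by (intro exI[of _ "mat 1"]) simp
  have mem: "c s \<in> general_linear_group" for s
    using inv1 by (simp add: c_def general_linear_group_def)
  have c0: "c 0 = mat 1" by (simp add: c_def)
  have "((\<lambda>s. mat 1 + s *\<^sub>R X) has_vector_derivative X) (at 0)"
    by (auto intro!: derivative_eq_intros)
  moreover have "\<forall>\<^sub>F s in at 0. mat 1 + s *\<^sub>R X = c s"
    using eventually_invertible[of X] by eventually_elim (simp add: c_def)
  ultimately have "(c has_vector_derivative X) (at 0)"
    unfolding has_vector_derivative_def
    by (rule has_derivative_transform_eventually) (simp_all add: c_def)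
  then show "X \<in> lie_algebra general_linear_group"
    using mem c0 unfolding lie_algebra_def by blast
qed

end

theory Submission
  imports Defs
begin

text \<open>
  The right-hand side of the moving equation depends on the curve only through its tangent
  \<open>\<phi> = u\<^sub>x\<close>; call it the flux \<open>F\<close> of \<open>\<phi>\<close>. The equation for \<open>\<phi>\<close> is the conservation law
  \<open>\<phi>\<^sub>t = F\<^sub>x\<close>, and a curve \<open>u\<close> is a potential of the closed form \<open>\<phi> dx + F dt\<close>. So one direction
  is the symmetry of second derivatives (\<open>dt_dx_commute\<close>) and the other is the Poincare lemma on
  the strip (\<open>closed_form_potential\<close>).

  That \<open>F\<^sub>x\<close> is the right-hand side of the orbit equation (\<open>dx_flux\<close>) is immediate for the terms with
  \<open>\<alpha>\<close> and \<open>\<beta>\<close>. For the cubic term \<open>Q = \<phi>\<^sub>x \<phi>\<inverse> \<phi>\<^sub>x \<phi>\<inverse> \<phi>\<^sub>x\<close> one needs \<open>[\<phi>\<^sub>x, Q] = 0\<close>. Here the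
  orbit enters: \<open>\<sigma>\<^sub>3\<^sup>2 = c I\<close> with \<open>c = -1/4\<close> or \<open>c = 1/4\<close>, hence \<open>\<phi>\<^sup>2 = c I\<close> along the whole
  orbit. Consequently \<open>\<phi>\<inverse> = \<phi> / c\<close>, and differentiating shows that \<open>\<phi>\<^sub>x\<close> anticommutes with \<open>\<phi>\<close>; therefore
  \<open>Q = - \<phi>\<^sub>x\<^sup>3 / c\<close>, which commutes with \<open>\<phi>\<^sub>x\<close> (\<open>triple_product_eq_cubic\<close>).

  It remains to see that the potential takes values in the Lie algebra. In each of the three cases
  the Lie algebra is the kernel of a linear map \<open>L\<close>, contains the orbit, and is closed under
  commutators and cubes. Hence \<open>L\<close> annihilates \<open>\<phi>\<close>, its \<open>x\<close>-derivatives and \<open>F\<close>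
  (\<open>flux_mem_kernel\<close>), and it commutes with the integrals that define the potential.
\<close>

section \<open>Primitives by radial integration\<close>

text \<open>
  The primitive \<open>\<integral> g\<close> from \<open>0\<close> to \<open>x\<close>, with the integration variable rescaled to \<open>[0, 1]\<close>. In this
  form \<open>x\<close> may be negative, and the domain of integration is fixed, so that derivatives in \<open>x\<close> and in
  a further parameter of \<open>g\<close> are both found by differentiation under the integral sign.
\<close>

definition radial_primitive :: "(real \<Rightarrow> 'v::euclidean_space) \<Rightarrow> real \<Rightarrow> 'v"
  where "radial_primitive g x = x *\<^sub>R integral {0..1} (\<lambda>r. g (r * x))"

lemma convex_scale_mem:
  fixes J :: "real set"
  assumes "convex J" "0 \<in> J" "x \<in> J" "r \<in> {0..1}"
  shows "r * x \<in> J"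
  using convexD[OF assms(1,3,2), of r "1 - r"] assms(4) by simp

lemma has_vector_derivative_scale:
  fixes J :: "real set" and g g' :: "real \<Rightarrow> 'v::real_normed_vector"
  assumes J: "convex J" "0 \<in> J" "x \<in> J" "r \<in> {0..1}"
    and g: "\<And>y. y \<in> J \<Longrightarrow> (g has_vector_derivative g' y) (at y within J)"
  shows "((\<lambda>r. g (r * x)) has_vector_derivative x *\<^sub>R g' (r * x)) (at r within {0..1})"
proof -
  have "((\<lambda>r. r * x) has_vector_derivative x) (at r within {0..1})"
    by (auto intro!: derivative_eq_intros simp flip: has_real_derivative_iff_has_vector_derivative)
  moreover have "(g has_vector_derivative g' (r * x)) (at (r * x) within (\<lambda>r. r * x) ` {0..1})"
    by (rule has_vector_derivative_within_subset[OF g]) (use J convex_scale_mem[OF J(1,2,3)] in auto)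
  ultimately show ?thesis
    using vector_diff_chain_within[of "\<lambda>r. r * x" x r "{0..1}" g] by (simp add: o_def)
qed

text \<open>
  The fundamental theorem of calculus for \<open>r \<mapsto> g (r x)\<close>.
\<close>

lemma radial_primitive_derivative:
  fixes g g' :: "real \<Rightarrow> 'v::euclidean_space"
  assumes J: "convex J" "0 \<in> J" "x \<in> J"
    and g: "\<And>y. y \<in> J \<Longrightarrow> (g has_vector_derivative g' y) (at y within J)"
  shows "radial_primitive g' x = g x - g 0"
proof -
  have "((\<lambda>r. x *\<^sub>R g' (r * x)) has_integral g (1 * x) - g (0 * x)) {0..1}"
    by (rule fundamental_theorem_of_calculus) (use has_vector_derivative_scale[OF J _ g] in auto)
  then show ?thesis
    by (simp add: radial_primitive_def integral_unique flip: integral_cmul)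
qed

text \<open>
  Differentiation under the integral sign and the product rule give the derivative
  \<open>\<integral> (g (r x) + r x g' (r x)) dr\<close>, whose integrand is the derivative of \<open>r \<mapsto> r g (r x)\<close>. The derivative
  is taken within \<open>J\<close>, so that the lemma serves for the time interval with its end point \<open>0\<close>, too.
\<close>

lemma has_vector_derivative_radial_primitive:
  fixes g g' :: "real \<Rightarrow> 'v::euclidean_space"
  assumes J: "convex J" "0 \<in> J" "x \<in> J"
    and g: "\<And>y. y \<in> J \<Longrightarrow> (g has_vector_derivative g' y) (at y within J)"
    and cont: "continuous_on J g'"
  shows "(radial_primitive g has_vector_derivative g x) (at x within J)"
proof -
  have mem: "r * y \<in> J" if "y \<in> J" "r \<in> {0..1}" for r y
    using convex_scale_mem[OF J(1,2) that] .
  have contg: "continuous_on J g"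
    using g has_vector_derivative_continuous continuous_on_eq_continuous_within by blast
  have cg: "continuous_on {0..1} (\<lambda>r. g (r * y))" if "y \<in> J" for y
    by (rule continuous_on_compose2[OF contg]) (auto intro!: continuous_intros mem that)
  have cg': "continuous_on {0..1} (\<lambda>r. g' (r * y))" if "y \<in> J" for y
    by (rule continuous_on_compose2[OF cont]) (auto intro!: continuous_intros mem that)
  have leib: "((\<lambda>y. integral (cbox 0 1) (\<lambda>r. g (r * y)))
      has_vector_derivative integral (cbox 0 1) (\<lambda>r. r *\<^sub>R g' (r * x))) (at x within J)"
  proof (rule leibniz_rule_vector_derivative[OF _ _ _ J(3,1)])
    fix y r :: real assume y: "y \<in> J" and r: "r \<in> cbox 0 1"
    have "((\<lambda>y. r * y) has_vector_derivative r) (at y within J)"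
      by (auto intro!: derivative_eq_intros simp flip: has_real_derivative_iff_has_vector_derivative)
    moreover have "(g has_vector_derivative g' (r * y)) (at (r * y) within (\<lambda>y. r * y) ` J)"
      by (rule has_vector_derivative_within_subset[OF g]) (use y r mem in auto)
    ultimately show "((\<lambda>y. g (r * y)) has_vector_derivative r *\<^sub>R g' (r * y)) (at y within J)"
      using vector_diff_chain_within[of "\<lambda>y. r * y" r y J g] by (simp add: o_def)
  next
    fix y assume "y \<in> J"
    then show "(\<lambda>r. g (r * y)) integrable_on cbox 0 1"
      using integrable_continuous_real[OF cg] by (simp add: cbox_interval)
  next
    have "continuous_on (J \<times> cbox 0 1) (\<lambda>p. g' (snd p * fst p))"
      by (rule continuous_on_compose2[OF cont]) (auto intro!: continuous_intros mem)
    then show "continuous_on (J \<times> cbox 0 1) (\<lambda>(y, r). r *\<^sub>R g' (r * y))"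
      by (auto simp: case_prod_unfold intro!: continuous_intros)
  qed
  have "(radial_primitive g has_vector_derivative
      x *\<^sub>R integral {0..1} (\<lambda>r. r *\<^sub>R g' (r * x)) + 1 *\<^sub>R integral {0..1} (\<lambda>r. g (r * x))) (at x within J)"
    unfolding radial_primitive_def[abs_def]
    using has_vector_derivative_scaleR[OF DERIV_ident leib] by (simp add: cbox_interval)
  \<comment> \<open>The integrand is the derivative of \<open>r \<mapsto> r g (r x)\<close>, which runs from \<open>0\<close> to \<open>g x\<close>.\<close>
  moreover have "((\<lambda>r. r *\<^sub>R x *\<^sub>R g' (r * x) + 1 *\<^sub>R g (r * x)) has_integral 1 *\<^sub>R g (1 * x) - 0 *\<^sub>R g (0 * x)) {0..1}"
  proof (rule fundamental_theorem_of_calculus)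
    fix r :: real assume "r \<in> {0..1}"
    show "((\<lambda>r. r *\<^sub>R g (r * x)) has_vector_derivative r *\<^sub>R x *\<^sub>R g' (r * x) + 1 *\<^sub>R g (r * x))
        (at r within {0..1})"
      by (rule has_vector_derivative_scaleR[OF DERIV_ident has_vector_derivative_scale[OF J _ g]]) fact+
  qed simp
  then have "integral {0..1} (\<lambda>r. r *\<^sub>R x *\<^sub>R g' (r * x) + g (r * x)) = g x"
    by (simp add: integral_unique)
  moreover have "integral {0..1} (\<lambda>r. r *\<^sub>R x *\<^sub>R g' (r * x) + g (r * x)) =
      integral {0..1} (\<lambda>r. x *\<^sub>R r *\<^sub>R g' (r * x)) + integral {0..1} (\<lambda>r. g (r * x))"
    by (subst integral_add)
      (auto intro!: integrable_continuous_real continuous_intros cg cg' J simp: mult.commute)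
  moreover have "integral {0..1} (\<lambda>r. x *\<^sub>R r *\<^sub>R g' (r * x)) = x *\<^sub>R integral {0..1} (\<lambda>r. r *\<^sub>R g' (r * x))"
    by (rule integral_cmul)
  ultimately show ?thesis by (simp only: scaleR_one)
qed

lemma radial_primitive_bounded_linear:
  fixes g :: "real \<Rightarrow> 'v::euclidean_space" and L :: "'v \<Rightarrow> 'w::euclidean_space"
  assumes "bounded_linear L" "convex J" "0 \<in> J" "x \<in> J" "continuous_on J g"
  shows "L (radial_primitive g x) = radial_primitive (\<lambda>y. L (g y)) x"
proof -
  have "continuous_on {0..1} (\<lambda>r. g (r * x))"
    by (rule continuous_on_compose2[OF assms(5)])
      (auto intro!: continuous_intros convex_scale_mem assms)
  then have "integral {0..1} (L \<circ> (\<lambda>r. g (r * x))) = L (integral {0..1} (\<lambda>r. g (r * x)))"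
    by (intro integral_linear assms integrable_continuous_real)
  then show ?thesis
    by (simp add: radial_primitive_def o_def linear_simps(5)[OF assms(1)])
qed


section \<open>Smooth functions on a strip\<close>

text \<open>
  The time intervals \<open>[0, T)\<close> enter only through these properties: convexity for differentiation under
  the integral sign and for radial integration from \<open>0\<close>, and more than one point for the uniqueness of
  derivatives within the interval.
\<close>

locale strip =
  fixes I :: "real set"
  assumes convex_I: "convex I" and zero_I: "0 \<in> I" and nontrivial_I: "\<nexists>a. I = {a}"

lemma strip_time_interval:
  assumes "0 < T"
  shows "strip (time_interval T)"
proof
  have *: "t \<in> time_interval T" if "0 \<le> t" "t \<le> s" "s \<in> time_interval T" for s t
    using that le_less_trans[of "ereal t" "ereal s" T] by (auto simp: time_interval_def)
  have "is_interval (time_interval T)"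
    unfolding is_interval_1 using * by (force simp: time_interval_def)
  then show "convex (time_interval T)" by (simp add: is_interval_convex_1)
  show 0: "0 \<in> time_interval T"
    using assms by (simp add: time_interval_def zero_ereal_def)
  obtain s :: real where "0 < ereal s" "ereal s < T"
    using ereal_dense2[OF assms] by auto
  then have "s \<in> time_interval T" "s \<noteq> 0" by (auto simp: time_interval_def)
  then show "\<nexists>a. time_interval T = {a}" using 0 by auto
qed

lemma dt_cong:
  assumes "\<And>s. s \<in> I \<Longrightarrow> f s x = g s x" "t \<in> I"
  shows "dt I f t x = dt I g t x"
proof -
  have "((\<lambda>s. f s x) has_vector_derivative D) (at t within I) \<longleftrightarrow>
      ((\<lambda>s. g s x) has_vector_derivative D) (at t within I)" for D
    using assms has_vector_derivative_transform[of t I "\<lambda>s. f s x" "\<lambda>s. g s x"]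
      has_vector_derivative_transform[of t I "\<lambda>s. g s x" "\<lambda>s. f s x"] by auto
  then show ?thesis by (simp add: dt_def vector_derivative_def)
qed

lemma dx_cong:
  assumes "\<And>y. f t y = g t y"
  shows "dx f t x = dx g t x"
  using assms by (simp add: dx_def)

lemma C_k_on_cong:
  assumes "C_k_on m I f" "\<And>t x. t \<in> I \<Longrightarrow> f t x = g t x"
  shows "C_k_on m I g"
  using assms
proof (induction m arbitrary: f g)
  case 0
  have "continuous_on (I \<times> UNIV) (\<lambda>(t, x). f t x) \<longleftrightarrow> continuous_on (I \<times> UNIV) (\<lambda>(t, x). g t x)"
    by (rule continuous_on_cong) (use 0 in auto)
  with 0 show ?case by simp
next
  case (Suc m)
  have c: "continuous_on (I \<times> UNIV) (\<lambda>(t, x). f t x) \<longleftrightarrow> continuous_on (I \<times> UNIV) (\<lambda>(t, x). g t x)"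
    by (rule continuous_on_cong) (use Suc.prems in auto)
  have t: "(\<lambda>s. g s x) differentiable (at t within I)" if "t \<in> I" for t x
    by (rule differentiable_transform_within[of "\<lambda>s. f s x" t I 1]) (use Suc.prems that in auto)
  have x: "(\<lambda>y. g t y) differentiable (at x)" if "t \<in> I" for t x
  proof -
    have "g t = f t" using Suc.prems(2) that by auto
    then show ?thesis using Suc.prems(1) that by simp
  qed
  have "C_k_on m I (dt I g)" "C_k_on m I (dx g)"
    using Suc.prems(1) Suc.prems(2)
    by (auto intro!: Suc.IH[of "dt I f" "dt I g"] Suc.IH[of "dx f" "dx g"] intro: dt_cong dx_cong)
  with Suc.prems c t x show ?case by simp
qed

lemma C_k_on_Suc_imp: "C_k_on (Suc m) I f \<Longrightarrow> C_k_on m I f"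
proof (induction m arbitrary: f)
  case (Suc m)
  have "C_k_on (Suc m) I (dt I f)" "C_k_on (Suc m) I (dx f)"
    using Suc.prems C_k_on.simps(2)[of "Suc m" I f] by blast+
  from this[THEN Suc.IH] show ?case
    using Suc.prems C_k_on.simps(2)[of "Suc m" I f] C_k_on.simps(2)[of m I f] by blast
qed simp

lemma C_k_on_continuous: "C_k_on m I f \<Longrightarrow> continuous_on (I \<times> UNIV) (\<lambda>(t, x). f t x)"
  by (cases m) auto

lemma smooth_on_strip_continuous:
  "smooth_on_strip I f \<Longrightarrow> continuous_on (I \<times> UNIV) (\<lambda>(t, x). f t x)"
  unfolding smooth_on_strip_def by (auto dest: spec[of _ 0])

lemma smooth_on_strip_cong:
  "smooth_on_strip I f \<Longrightarrow> (\<And>t x. t \<in> I \<Longrightarrow> f t x = g t x) \<Longrightarrow> smooth_on_strip I g"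
  unfolding smooth_on_strip_def using C_k_on_cong by blast

lemma smooth_on_strip_dx: "smooth_on_strip I f \<Longrightarrow> smooth_on_strip I (dx f)"
  and smooth_on_strip_dt: "smooth_on_strip I f \<Longrightarrow> smooth_on_strip I (dt I f)"
  unfolding smooth_on_strip_def by (metis C_k_on.simps(2))+

lemma smooth_has_dt:
  assumes "smooth_on_strip I f" "t \<in> I"
  shows "((\<lambda>s. f s x) has_vector_derivative dt I f t x) (at t within I)"
proof -
  have "C_k_on 1 I f" using assms by (simp only: smooth_on_strip_def)
  with assms(2) show ?thesis by (simp add: dt_def vector_derivative_works)
qed

lemma smooth_has_dx:
  assumes "smooth_on_strip I f" "t \<in> I"
  shows "(f t has_vector_derivative dx f t x) (at x)"
proof -
  have "C_k_on 1 I f" using assms by (simp only: smooth_on_strip_def)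
  with assms(2) show ?thesis by (simp add: dx_def flip: vector_derivative_works)
qed

lemma smooth_continuous_slice:
  assumes "smooth_on_strip I f" "t \<in> I"
  shows "continuous_on UNIV (f t)"
  using smooth_has_dx[OF assms] has_vector_derivative_continuous
  by (simp add: continuous_on_eq_continuous_within) blast

lemma smooth_continuous_time_slice:
  assumes "smooth_on_strip I f"
  shows "continuous_on I (\<lambda>s. f s x)"
proof -
  have "continuous_on I (\<lambda>s. (\<lambda>(t, x). f t x) (s, x))"
    by (rule continuous_on_compose2[OF smooth_on_strip_continuous[OF assms]])
      (auto intro!: continuous_intros)
  then show ?thesis by simp
qed

lemma dxI: "(f t has_vector_derivative D) (at x) \<Longrightarrow> dx f t x = D"
  by (simp add: dx_def vector_derivative_at)

context strip
begin

lemma dtI: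
  assumes "((\<lambda>s. f s x) has_vector_derivative D) (at t within I)" "t \<in> I"
  shows "dt I f t x = D"
proof -
  have "t islimpt I"
    by (rule connected_imp_perfect) (use convex_I convex_connected nontrivial_I assms in auto)
  then show ?thesis
    using assms(1) by (auto simp: dt_def trivial_limit_within intro: vector_derivative_within)
qed

text \<open>
  This replaces the derivatives chosen by \<open>dt\<close> and \<open>dx\<close> by explicit candidates, which only have to agree
  with them on the strip.
\<close>

lemma C_k_on_SucI:
  assumes "continuous_on (I \<times> UNIV) (\<lambda>(t, x). f t x)"
    and t: "\<And>t x. t \<in> I \<Longrightarrow> ((\<lambda>s. f s x) has_vector_derivative ft t x) (at t within I)"
    and x: "\<And>t x. t \<in> I \<Longrightarrow> (f t has_vector_derivative fx t x) (at x)"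
    and "C_k_on m I ft" "C_k_on m I fx"
  shows "C_k_on (Suc m) I f"
proof -
  have "C_k_on m I (dt I f)"
    by (rule C_k_on_cong[OF assms(4)]) (simp add: dtI[OF t])
  moreover have "C_k_on m I (dx f)"
    by (rule C_k_on_cong[OF assms(5)]) (simp add: dxI[OF x])
  ultimately show ?thesis
    using assms(1) differentiableI_vector[OF t] differentiableI_vector[OF x] by simp
qed

lemma smooth_on_stripI:
  assumes "continuous_on (I \<times> UNIV) (\<lambda>(t, x). f t x)"
    and "\<And>t x. t \<in> I \<Longrightarrow> ((\<lambda>s. f s x) has_vector_derivative ft t x) (at t within I)"
    and "\<And>t x. t \<in> I \<Longrightarrow> (f t has_vector_derivative fx t x) (at x)"
    and "smooth_on_strip I ft" "smooth_on_strip I fx"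
  shows "smooth_on_strip I f"
  unfolding smooth_on_strip_def
proof
  fix m
  have "C_k_on m I ft" "C_k_on m I fx"
    using assms(4,5) by (simp_all add: smooth_on_strip_def)
  from C_k_on_SucI[OF assms(1-3) this] show "C_k_on m I f"
    by (rule C_k_on_Suc_imp)
qed

lemma C_k_on_has_derivatives:
  assumes "C_k_on (Suc m) I f" "t \<in> I"
  shows "((\<lambda>s. f s x) has_vector_derivative dt I f t x) (at t within I)"
    and "(f t has_vector_derivative dx f t x) (at x)"
proof -
  have "(\<lambda>s. f s x) differentiable (at t within I)" "f t differentiable (at x)"
    using assms by simp_all
  then show "((\<lambda>s. f s x) has_vector_derivative dt I f t x) (at t within I)"
    "(f t has_vector_derivative dx f t x) (at x)"
    unfolding dt_def dx_def vector_derivative_works .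
qed

lemma C_k_on_add:
  "C_k_on m I f \<Longrightarrow> C_k_on m I g \<Longrightarrow> C_k_on m I (\<lambda>t x. f t x + g t x)"
proof (induction m arbitrary: f g)
  case 0
  then have "continuous_on (I \<times> UNIV) (\<lambda>(t, x). f t x)" "continuous_on (I \<times> UNIV) (\<lambda>(t, x). g t x)"
    by simp_all
  from continuous_on_add[OF this] show ?case by (simp add: case_prod_unfold)
next
  case (Suc m)
  note D = C_k_on_has_derivatives[OF Suc.prems(1)] C_k_on_has_derivatives[OF Suc.prems(2)]
  show ?case
  proof (rule C_k_on_SucI)
    show "continuous_on (I \<times> UNIV) (\<lambda>(t, x). f t x + g t x)"
      using continuous_on_add[OF Suc.prems[THEN C_k_on_continuous]] by (simp add: case_prod_unfold)
    show "C_k_on m I (\<lambda>t x. dt I f t x + dt I g t x)" "C_k_on m I (\<lambda>t x. dx f t x + dx g t x)"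
      using Suc.prems by (simp_all add: Suc.IH)
  qed (simp_all add: has_vector_derivative_add D del: C_k_on.simps)
qed

lemma C_k_on_bilinear:
  fixes bil :: "'u::real_normed_vector \<Rightarrow> 'v::real_normed_vector \<Rightarrow> 'w::real_normed_vector"
  assumes bil: "bounded_bilinear bil"
  shows "C_k_on m I f \<Longrightarrow> C_k_on m I g \<Longrightarrow> C_k_on m I (\<lambda>t x. bil (f t x) (g t x))"
proof (induction m arbitrary: f g)
  case 0
  then have "continuous_on (I \<times> UNIV) (\<lambda>(t, x). f t x)" "continuous_on (I \<times> UNIV) (\<lambda>(t, x). g t x)"
    by simp_all
  from bounded_bilinear.continuous_on[OF bil this] show ?case by (simp add: case_prod_unfold)
next
  case (Suc m)
  note D = C_k_on_has_derivatives[OF Suc.prems(1)] C_k_on_has_derivatives[OF Suc.prems(2)]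
  show ?case
  proof (rule C_k_on_SucI)
    show "continuous_on (I \<times> UNIV) (\<lambda>(t, x). bil (f t x) (g t x))"
      using bounded_bilinear.continuous_on[OF bil Suc.prems[THEN C_k_on_continuous]]
      by (simp add: case_prod_unfold)
    show "C_k_on m I (\<lambda>t x. bil (f t x) (dt I g t x) + bil (dt I f t x) (g t x))"
      "C_k_on m I (\<lambda>t x. bil (f t x) (dx g t x) + bil (dx f t x) (g t x))"
      using Suc.prems[THEN C_k_on_Suc_imp] Suc.prems by (simp_all add: C_k_on_add Suc.IH)
    show "((\<lambda>s. bil (f s x) (g s x)) has_vector_derivative
        bil (f t x) (dt I g t x) + bil (dt I f t x) (g t x)) (at t within I)" if "t \<in> I" for t x
      by (rule bounded_bilinear.has_vector_derivative[OF bil D(1)[OF that] D(3)[OF that]])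
    show "((\<lambda>y. bil (f t y) (g t y)) has_vector_derivative
        bil (f t x) (dx g t x) + bil (dx f t x) (g t x)) (at x)" if "t \<in> I" for t x
      by (rule bounded_bilinear.has_vector_derivative[OF bil D(2)[OF that] D(4)[OF that]])
  qed
qed

lemma C_k_on_const: "C_k_on m I (\<lambda>t x. a)"
proof (induction m arbitrary: a)
  case (Suc m)
  show ?case
    by (rule C_k_on_SucI[where ft = "\<lambda>t x. 0" and fx = "\<lambda>t x. 0"]) (auto simp: Suc case_prod_unfold)
qed (simp add: case_prod_unfold)

lemma smooth_on_strip_add:
  "smooth_on_strip I f \<Longrightarrow> smooth_on_strip I g \<Longrightarrow> smooth_on_strip I (\<lambda>t x. f t x + g t x)"
  by (simp add: smooth_on_strip_def C_k_on_add)

lemma smooth_on_strip_bilinear: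
  "bounded_bilinear bil \<Longrightarrow> smooth_on_strip I f \<Longrightarrow> smooth_on_strip I h \<Longrightarrow>
    smooth_on_strip I (\<lambda>t x. bil (f t x) (h t x))"
  unfolding smooth_on_strip_def by (simp add: C_k_on_bilinear[where bil = bil])

lemma smooth_on_strip_scaleR:
  "smooth_on_strip I f \<Longrightarrow> smooth_on_strip I (\<lambda>t x. a *\<^sub>R f t x)"
  using smooth_on_strip_bilinear[OF bounded_bilinear_scaleR, of "\<lambda>t x. a" f]
  by (simp add: smooth_on_strip_def C_k_on_const)

lemma smooth_on_strip_diff:
  "smooth_on_strip I f \<Longrightarrow> smooth_on_strip I g \<Longrightarrow> smooth_on_strip I (\<lambda>t x. f t x - g t x)"
  using smooth_on_strip_add[of f "\<lambda>t x. (-1) *\<^sub>R g t x"] smooth_on_strip_scaleR[of g "-1"] by simp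

lemma continuous_on_radial_slice:
  assumes "continuous_on (I \<times> UNIV) (\<lambda>(t, x). f t x)"
  shows "continuous_on ((I \<times> UNIV) \<times> cbox 0 1) (\<lambda>(p, r). f (fst p) (r * snd p :: real))"
proof -
  have "continuous_on ((I \<times> UNIV) \<times> cbox 0 1) (\<lambda>q. (\<lambda>(t, x). f t x) (fst (fst q), snd q * snd (fst q)))"
    by (rule continuous_on_compose2[OF assms]) (auto intro!: continuous_intros)
  then show ?thesis by (simp add: case_prod_unfold)
qed

lemma continuous_on_radial_primitive:
  fixes f :: "real \<Rightarrow> real \<Rightarrow> 'v::euclidean_space"
  assumes "continuous_on (I \<times> UNIV) (\<lambda>(t, x). f t x)"
  shows "continuous_on (I \<times> UNIV) (\<lambda>(t, x). radial_primitive (f t) x)"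
proof -
  have "continuous_on (I \<times> UNIV) (\<lambda>p. integral (cbox 0 1) (\<lambda>r. f (fst p) (r * snd p)))"
    by (rule integral_continuous_on_param[OF continuous_on_radial_slice[OF assms]])
  then show ?thesis
    by (auto simp: radial_primitive_def case_prod_unfold cbox_interval intro!: continuous_intros)
qed

lemma has_dt_radial_primitive:
  fixes f :: "real \<Rightarrow> real \<Rightarrow> 'v::euclidean_space"
  assumes f: "smooth_on_strip I f" and t: "t \<in> I"
  shows "((\<lambda>s. radial_primitive (f s) x) has_vector_derivative radial_primitive (dt I f t) x)
    (at t within I)"
proof -
  have "((\<lambda>s. integral (cbox 0 1) (\<lambda>r. f s (r * x)))
      has_vector_derivative integral (cbox 0 1) (\<lambda>r. dt I f t (r * x))) (at t within I)"
  proof (rule leibniz_rule_vector_derivative[OF _ _ _ t convex_I])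
    fix s assume s: "s \<in> I"
    show "((\<lambda>s. f s (r * x)) has_vector_derivative dt I f s (r * x)) (at s within I)" for r
      by (rule smooth_has_dt[OF f s])
    have "continuous_on (cbox 0 1) (\<lambda>r. f s (r * x))"
      by (rule continuous_on_compose2[OF smooth_continuous_slice[OF f s]]) (auto intro!: continuous_intros)
    then show "(\<lambda>r. f s (r * x)) integrable_on cbox 0 1" by (rule integrable_continuous)
  next
    have "continuous_on (I \<times> cbox 0 1) (\<lambda>q. (\<lambda>(p, r). dt I f (fst p) (r * snd p)) ((fst q, x), snd q))"
      by (rule continuous_on_compose2[OF continuous_on_radial_slice[OF smooth_on_strip_continuous[OF
                smooth_on_strip_dt[OF f]]]])
        (auto intro!: continuous_intros)
    then show "continuous_on (I \<times> cbox 0 1) (\<lambda>(s, r). dt I f s (r * x))"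
      by (simp add: case_prod_unfold)
  qed
  from bounded_linear.has_vector_derivative[OF bounded_linear_scaleR_right this, of x]
  show ?thesis by (simp add: radial_primitive_def cbox_interval)
qed

lemma has_dx_radial_primitive:
  fixes f :: "real \<Rightarrow> real \<Rightarrow> 'v::euclidean_space"
  assumes f: "smooth_on_strip I f" and t: "t \<in> I"
  shows "(radial_primitive (f t) has_vector_derivative f t x) (at x)"
  by (rule has_vector_derivative_radial_primitive[where J = UNIV and g' = "dx f t"])
    (use smooth_has_dx[OF f t] smooth_continuous_slice[OF smooth_on_strip_dx[OF f] t] in auto)

lemma radial_primitive_dx:
  fixes f :: "real \<Rightarrow> real \<Rightarrow> 'v::euclidean_space"
  assumes f: "smooth_on_strip I f" and t: "t \<in> I"
  shows "radial_primitive (dx f t) x = f t x - f t 0"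
  by (rule radial_primitive_derivative[where J = UNIV]) (use smooth_has_dx[OF f t] in auto)

text \<open>
  Both mixed derivatives are read off from \<open>u t x - u t 0\<close>, the primitive of \<open>u\<^sub>x\<close>: differentiating in
  \<open>t\<close> under the integral sign shows that \<open>u\<^sub>t t x - u\<^sub>t t 0\<close> is the primitive of \<open>u\<^sub>x\<^sub>t\<close>, and
  differentiating this in \<open>x\<close> gives \<open>u\<^sub>t\<^sub>x = u\<^sub>x\<^sub>t\<close>.
\<close>

lemma dt_dx_commute:
  fixes u :: "real \<Rightarrow> real \<Rightarrow> 'v::euclidean_space"
  assumes u: "smooth_on_strip I u" and t: "t \<in> I"
  shows "dt I (dx u) t x = dx (dt I u) t x"
proof -
  have *: "dt I u t y - dt I u t 0 = radial_primitive (dt I (dx u) t) y" for y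
  proof -
    have 1: "((\<lambda>s. u s y - u s 0) has_vector_derivative dt I u t y - dt I u t 0) (at t within I)"
      by (intro has_vector_derivative_diff smooth_has_dt u t)
    have 2: "((\<lambda>s. u s y - u s 0) has_vector_derivative radial_primitive (dt I (dx u) t) y)
        (at t within I)"
      by (rule has_vector_derivative_transform[OF t _ has_dt_radial_primitive[OF smooth_on_strip_dx[OF u] t]])
        (simp add: radial_primitive_dx[OF u])
    show ?thesis
      using dtI[of "\<lambda>s y. u s y - u s 0", OF 1 t] dtI[of "\<lambda>s y. u s y - u s 0", OF 2 t]
      by (rule trans[OF sym])
  qed
  have "dt I u t = (\<lambda>y. radial_primitive (dt I (dx u) t) y + dt I u t 0)"
    by (simp flip: *)
  moreover have "((\<lambda>y. radial_primitive (dt I (dx u) t) y + dt I u t 0) has_vector_derivative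
      dt I (dx u) t x + 0) (at x)"
    by (intro has_vector_derivative_add has_dx_radial_primitive smooth_on_strip_dt smooth_on_strip_dx
        u t has_vector_derivative_const)
  ultimately have "dx (dt I u) t x = dt I (dx u) t x + 0"
    by (intro dxI) simp
  then show ?thesis by simp
qed

text \<open>
  The Poincare lemma for \<open>f dx + F dt\<close>: integrate along the \<open>t\<close>-axis from the origin to \<open>(t, 0)\<close> and
  then in the \<open>x\<close>-direction. The time derivative of the second integral is the integral of
  \<open>f\<^sub>t = F\<^sub>x\<close>, which is \<open>F t x - F t 0\<close>; that of
  the first integral is the missing \<open>F t 0\<close>.
\<close>

lemma closed_form_potential:
  fixes f F :: "real \<Rightarrow> real \<Rightarrow> 'v::euclidean_space"
  assumes f: "smooth_on_strip I f" and F: "smooth_on_strip I F"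
    and closed: "\<And>t x. t \<in> I \<Longrightarrow> dt I f t x = dx F t x"
  defines "u \<equiv> \<lambda>t x. radial_primitive (f t) x + radial_primitive (\<lambda>s. F s 0) t"
  shows "smooth_on_strip I u"
    and "t \<in> I \<Longrightarrow> dx u t x = f t x"
    and "t \<in> I \<Longrightarrow> dt I u t x = F t x"
proof -
  have cont0: "continuous_on I (\<lambda>s. dt I F s 0)"
    by (rule smooth_continuous_time_slice[OF smooth_on_strip_dt[OF F]])
  have F0: "(radial_primitive (\<lambda>s. F s 0) has_vector_derivative F t 0) (at t within I)" if "t \<in> I" for t
    by (rule has_vector_derivative_radial_primitive[OF convex_I zero_I that smooth_has_dt[OF F] cont0])
  have ut: "((\<lambda>s. u s x) has_vector_derivative F t x) (at t within I)" if t: "t \<in> I" for t x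
  proof -
    have "dt I f t = dx F t" using closed[OF t] by auto
    then have "radial_primitive (dt I f t) x + F t 0 = F t x"
      by (simp add: radial_primitive_dx[OF F t])
    then show ?thesis
      using has_vector_derivative_add[OF has_dt_radial_primitive[OF f t, of x] F0[OF t]]
      by (simp add: u_def)
  qed
  have ux: "(u t has_vector_derivative f t x) (at x)" if t: "t \<in> I" for t x
    using has_vector_derivative_add[OF has_dx_radial_primitive[OF f t] has_vector_derivative_const]
    by (simp add: u_def)
  have "continuous_on I (radial_primitive (\<lambda>s. F s 0))"
    using F0 has_vector_derivative_continuous continuous_on_eq_continuous_within by blast
  then have "continuous_on (I \<times> (UNIV :: real set)) (\<lambda>p. radial_primitive (\<lambda>s. F s 0) (fst p))"
    by (rule continuous_on_compose2) (auto intro!: continuous_intros)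
  then have "continuous_on (I \<times> UNIV) (\<lambda>(t, x). u t x)"
    using continuous_on_radial_primitive[OF smooth_on_strip_continuous[OF f]]
    by (auto simp: u_def case_prod_unfold intro!: continuous_intros)
  then show "smooth_on_strip I u"
    using ut ux F f by (rule smooth_on_stripI)
  show "dx u t x = f t x" if "t \<in> I" using dxI[of u t "f t x" x] ux[OF that] by blast
  show "dt I u t x = F t x" if "t \<in> I" using dtI[of u x "F t x" t] ut[OF that] that by blast
qed

end

section \<open>Matrices whose square is scalar\<close>

lemma bounded_bilinear_commutator:
  "bounded_bilinear (commutator :: ('a::{real_normed_field,euclidean_space}^'n^'n) \<Rightarrow> 'a^'n^'n \<Rightarrow> 'a^'n^'n)"
proof -
  interpret mm: bounded_bilinear "(**) :: ('a^'n^'n) \<Rightarrow> 'a^'n^'n \<Rightarrow> 'a^'n^'n"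
    by (rule bounded_bilinear_matrix_mult)
  have "bilinear (commutator :: ('a^'n^'n) \<Rightarrow> 'a^'n^'n \<Rightarrow> 'a^'n^'n)"
    unfolding bilinear_def commutator_def
    by (auto intro!: linearI simp: mm.add_left mm.add_right mm.scaleR_left mm.scaleR_right
        scaleR_diff_right)
  then show ?thesis by (simp add: bilinear_conv_bounded_bilinear)
qed

lemma commutator_self [simp]: "commutator X X = 0"
  by (simp add: commutator_def)

lemma commutator_cube [simp]: "commutator X (X ** X ** X) = 0"
  by (simp add: commutator_def matrix_mul_assoc)

lemma orbit_square:
  fixes A :: "'a::{real_normed_field,euclidean_space}^'n^'n"
  assumes G: "\<And>E. E \<in> G \<Longrightarrow> invertible E" and A: "A ** A = c *\<^sub>R mat 1"
    and X: "X \<in> orbit G A"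
  shows "X ** X = c *\<^sub>R mat 1"
proof -
  interpret mm: bounded_bilinear "(**) :: ('a^'n^'n) \<Rightarrow> 'a^'n^'n \<Rightarrow> 'a^'n^'n"
    by (rule bounded_bilinear_matrix_mult)
  obtain E where E: "E \<in> G" "X = matrix_inv E ** A ** E"
    using X by (auto simp: orbit_def)
  have "X ** X = matrix_inv E ** A ** (E ** matrix_inv E) ** A ** E"
    by (simp add: E matrix_mul_assoc)
  also have "\<dots> = matrix_inv E ** (A ** A) ** E"
    by (simp add: matrix_inv_right[OF G[OF E(1)]] matrix_mul_assoc)
  also have "\<dots> = c *\<^sub>R mat 1"
    by (simp add: A mm.scaleR_left mm.scaleR_right matrix_inv_left[OF G[OF E(1)]])
  finally show ?thesis .
qed

lemma matrix_inv_square_scalar: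
  fixes X :: "'a::{real_normed_field,euclidean_space}^'n^'n"
  assumes X: "X ** X = c *\<^sub>R mat 1" and c: "c \<noteq> 0"
  shows "matrix_inv X = (1 / c) *\<^sub>R X"
proof -
  interpret mm: bounded_bilinear "(**) :: ('a^'n^'n) \<Rightarrow> 'a^'n^'n \<Rightarrow> 'a^'n^'n"
    by (rule bounded_bilinear_matrix_mult)
  have 1: "X ** ((1 / c) *\<^sub>R X) = mat 1" "((1 / c) *\<^sub>R X) ** X = mat 1"
    using c by (simp_all add: mm.scaleR_left mm.scaleR_right X)
  then have "invertible X" unfolding invertible_def by blast
  then have "matrix_inv X ** (X ** ((1 / c) *\<^sub>R X)) = (1 / c) *\<^sub>R X"
    by (simp add: matrix_inv_left matrix_mul_assoc)
  then show ?thesis by (simp add: 1)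
qed

text \<open>
  Replace \<open>X\<inverse>\<close> by \<open>X / c\<close> and move one \<open>X\<close> past the middle \<open>Y\<close>, at the price of a sign, so that the
  two factors \<open>X\<close> meet and become the scalar \<open>c\<close>.
\<close>

lemma anticommuting_triple_product:
  fixes X Y :: "'a::{real_normed_field,euclidean_space}^'n^'n"
  assumes X: "X ** X = c *\<^sub>R mat 1" and c: "c \<noteq> 0" and XY: "Y ** X = - (X ** Y)"
  shows "Y ** matrix_inv X ** Y ** matrix_inv X ** Y = (- 1 / c) *\<^sub>R (Y ** Y ** Y)"
proof -
  interpret mm: bounded_bilinear "(**) :: ('a^'n^'n) \<Rightarrow> 'a^'n^'n \<Rightarrow> 'a^'n^'n"
    by (rule bounded_bilinear_matrix_mult)
  have "Y ** X ** Y ** X ** Y = Y ** X ** (Y ** X) ** Y"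
    by (simp add: matrix_mul_assoc)
  also have "\<dots> = - (Y ** (X ** X) ** Y ** Y)"
    unfolding XY[THEN arg_cong[where f = "\<lambda>Z. Y ** X ** Z ** Y"]]
    by (simp add: mm.minus_left mm.minus_right matrix_mul_assoc)
  also have "\<dots> = - (c *\<^sub>R (Y ** Y ** Y))"
    by (simp add: X mm.scaleR_left mm.scaleR_right)
  finally show ?thesis
    using c by (simp add: matrix_inv_square_scalar[OF X c] mm.scaleR_left mm.scaleR_right)
qed


section \<open>The flux\<close>

text \<open>
  The right-hand side of the moving equation, as a function of the tangent \<open>\<phi> = u\<^sub>x\<close>.
\<close>

definition flux :: "real \<Rightarrow> real \<Rightarrow> real \<Rightarrow> (real \<Rightarrow> real \<Rightarrow> 'a::real_normed_field^'n^'n)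
    \<Rightarrow> real \<Rightarrow> real \<Rightarrow> 'a^'n^'n"
  where "flux \<alpha> \<beta> \<gamma> \<phi> t x =
    - \<alpha> *\<^sub>R commutator (\<phi> t x) (dx \<phi> t x)
    + \<beta> *\<^sub>R (commutator (\<phi> t x) ((dx ^^ 3) \<phi> t x) - commutator (dx \<phi> t x) ((dx ^^ 2) \<phi> t x))
    + (4 * \<gamma> - 2 * \<beta>) *\<^sub>R
        commutator (\<phi> t x) (dx \<phi> t x ** matrix_inv (\<phi> t x) ** dx \<phi> t x
          ** matrix_inv (\<phi> t x) ** dx \<phi> t x)"

lemma funpow_dx_Suc: "(dx ^^ Suc n) f = (dx ^^ n) (dx f)"
  by (simp only: funpow_Suc_right o_apply)

lemma smooth_on_strip_funpow_dx: "smooth_on_strip I f \<Longrightarrow> smooth_on_strip I ((dx ^^ n) f)"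
  by (induction n) (auto intro: smooth_on_strip_dx)

lemma funpow_dx_cong:
  "(\<And>t x. t \<in> I \<Longrightarrow> f t x = g t x) \<Longrightarrow> t \<in> I \<Longrightarrow> (dx ^^ n) f t x = (dx ^^ n) g t x"
  by (induction n arbitrary: x) (auto intro: dx_cong)

lemma flux_cong:
  assumes "\<And>t x. t \<in> I \<Longrightarrow> f t x = g t x" "t \<in> I"
  shows "flux \<alpha> \<beta> \<gamma> f t x = flux \<alpha> \<beta> \<gamma> g t x"
proof -
  have "(dx ^^ n) f t x = (dx ^^ n) g t x" for n
    by (rule funpow_dx_cong[OF assms])
  from this[of 0] this[of 1] this[of 2] this[of 3] show ?thesis
    by (simp add: flux_def)
qed

text \<open>
  The curve enters the right-hand side of the moving equation only through its tangent.
\<close>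

lemma moving_solution_iff_flux:
  "moving_solution T \<alpha> \<beta> \<gamma> G A u \<longleftrightarrow>
    smooth_on_strip (time_interval T) u \<and>
    (\<forall>t\<in>time_interval T. \<forall>x. u t x \<in> lie_algebra G \<and> dx u t x \<in> orbit G A) \<and>
    (\<forall>t\<in>time_interval T. \<forall>x. dt (time_interval T) u t x = flux \<alpha> \<beta> \<gamma> (dx u) t x)"
proof -
  have "(dx ^^ 2) u = dx (dx u)" "(dx ^^ 3) u = (dx ^^ 2) (dx u)" "(dx ^^ 4) u = (dx ^^ 3) (dx u)"
    using funpow_dx_Suc[of 1 u] funpow_dx_Suc[of 2 u] funpow_dx_Suc[of 3 u]
    by (simp_all add: eval_nat_numeral)
  then show ?thesis by (simp add: moving_solution_def flux_def Let_def)
qed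

locale scalar_square_flow = strip I
  for I :: "real set" +
  fixes c :: real and \<phi> :: "real \<Rightarrow> real \<Rightarrow> 'a::{real_normed_field,euclidean_space}^'n^'n"
  assumes c: "c \<noteq> 0" and smooth: "smooth_on_strip I \<phi>"
    and square: "\<And>t x. t \<in> I \<Longrightarrow> \<phi> t x ** \<phi> t x = c *\<^sub>R mat 1"
begin

sublocale mm: bounded_bilinear "(**) :: ('a^'n^'n) \<Rightarrow> 'a^'n^'n \<Rightarrow> 'a^'n^'n"
  by (rule bounded_bilinear_matrix_mult)

sublocale comm: bounded_bilinear "commutator :: ('a^'n^'n) \<Rightarrow> 'a^'n^'n \<Rightarrow> 'a^'n^'n"
  by (rule bounded_bilinear_commutator)

definition cubic :: "real \<Rightarrow> real \<Rightarrow> 'a^'n^'n"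
  where "cubic t x = (- 1 / c) *\<^sub>R (dx \<phi> t x ** dx \<phi> t x ** dx \<phi> t x)"

text \<open>
  The derivative of the constant \<open>\<phi>\<^sup>2 = c I\<close> vanishes.
\<close>

lemma dx_anticommutes:
  assumes t: "t \<in> I"
  shows "dx \<phi> t x ** \<phi> t x = - (\<phi> t x ** dx \<phi> t x)"
proof -
  have "((\<lambda>y. \<phi> t y ** \<phi> t y) has_vector_derivative \<phi> t x ** dx \<phi> t x + dx \<phi> t x ** \<phi> t x) (at x)"
    by (rule mm.has_vector_derivative[OF smooth_has_dx[OF smooth t] smooth_has_dx[OF smooth t]])
  then have "((\<lambda>y. c *\<^sub>R mat 1 :: 'a^'n^'n) has_vector_derivative
      \<phi> t x ** dx \<phi> t x + dx \<phi> t x ** \<phi> t x) (at x)"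
    by (simp add: square[OF t])
  then have "\<phi> t x ** dx \<phi> t x + dx \<phi> t x ** \<phi> t x = 0"
    using has_vector_derivative_const vector_derivative_unique_at by blast
  then show ?thesis by (simp add: eq_neg_iff_add_eq_0 add.commute)
qed

lemma triple_product_eq_cubic:
  assumes "t \<in> I"
  shows "dx \<phi> t x ** matrix_inv (\<phi> t x) ** dx \<phi> t x ** matrix_inv (\<phi> t x) ** dx \<phi> t x = cubic t x"
  unfolding cubic_def
  by (rule anticommuting_triple_product[OF square[OF assms] c dx_anticommutes[OF assms]])

lemma smooth_cubic: "smooth_on_strip I cubic"
  unfolding cubic_def[abs_def]
  by (intro smooth_on_strip_scaleR smooth_on_strip_bilinear[OF mm.bounded_bilinear_axioms]
      smooth_on_strip_dx smooth)

lemma flux_eq: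
  assumes "t \<in> I"
  shows "flux \<alpha> \<beta> \<gamma> \<phi> t x =
    - \<alpha> *\<^sub>R commutator (\<phi> t x) (dx \<phi> t x)
    + \<beta> *\<^sub>R (commutator (\<phi> t x) ((dx ^^ 3) \<phi> t x) - commutator (dx \<phi> t x) ((dx ^^ 2) \<phi> t x))
    + (4 * \<gamma> - 2 * \<beta>) *\<^sub>R commutator (\<phi> t x) (cubic t x)"
  by (simp only: flux_def triple_product_eq_cubic[OF assms])

lemma smooth_flux: "smooth_on_strip I (flux \<alpha> \<beta> \<gamma> \<phi>)"
proof (rule smooth_on_strip_cong)
  show "smooth_on_strip I (\<lambda>t x.
      - \<alpha> *\<^sub>R commutator (\<phi> t x) (dx \<phi> t x)
      + \<beta> *\<^sub>R (commutator (\<phi> t x) ((dx ^^ 3) \<phi> t x) - commutator (dx \<phi> t x) ((dx ^^ 2) \<phi> t x))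
      + (4 * \<gamma> - 2 * \<beta>) *\<^sub>R commutator (\<phi> t x) (cubic t x))"
    by (intro smooth_on_strip_add smooth_on_strip_diff smooth_on_strip_scaleR
        smooth_on_strip_bilinear[OF comm.bounded_bilinear_axioms]
        smooth_on_strip_funpow_dx smooth_on_strip_dx smooth smooth_cubic)
qed (simp add: flux_eq)

text \<open>
  In each derivative of a bracket the unwanted terms vanish: \<open>[\<phi>\<^sub>x, \<phi>\<^sub>x]\<close> for \<open>\<alpha>\<close>; for \<open>\<beta>\<close> the
  two occurrences of \<open>[\<phi>\<^sub>x, \<phi>\<^sub>x\<^sub>x\<^sub>x]\<close> cancel; and \<open>[\<phi>\<^sub>x, Q] = 0\<close> for the cubic term \<open>Q\<close>, because it is a
  multiple of \<open>\<phi>\<^sub>x\<^sup>3\<close>.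
\<close>

lemma dx_flux:
  assumes t: "t \<in> I"
  shows "dx (flux \<alpha> \<beta> \<gamma> \<phi>) t x =
    commutator (\<phi> t x)
      (- \<alpha> *\<^sub>R (dx ^^ 2) \<phi> t x
       + \<beta> *\<^sub>R (dx ^^ 4) \<phi> t x
       + (4 * \<gamma> - 2 * \<beta>) *\<^sub>R
           dx (\<lambda>s y. dx \<phi> s y ** matrix_inv (\<phi> s y) ** dx \<phi> s y
                     ** matrix_inv (\<phi> s y) ** dx \<phi> s y) t x)"
proof -
  have D: "((dx ^^ n) \<phi> t has_vector_derivative (dx ^^ Suc n) \<phi> t x) (at x)" for n
    using smooth_has_dx[OF smooth_on_strip_funpow_dx[OF smooth] t] by simp
  note D0 = D[of 0] and D1 = D[of 1] and D2 = D[of 2] and D3 = D[of 3]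
  note bil = comm.has_vector_derivative
  \<comment> \<open>The vanishing term is kept because the product rule produces it.\<close>
  have "commutator (dx \<phi> t x) (cubic t x) = 0"
    by (simp add: cubic_def comm.scaleR_right comm.minus_right)
  then have c0: "commutator (\<phi> t x) (dx cubic t x) =
      commutator (\<phi> t x) (dx cubic t x) + commutator (dx \<phi> t x) (cubic t x)" by simp
  have "((\<lambda>y. - \<alpha> *\<^sub>R commutator (\<phi> t y) (dx \<phi> t y)
      + \<beta> *\<^sub>R (commutator (\<phi> t y) ((dx ^^ 3) \<phi> t y) - commutator (dx \<phi> t y) ((dx ^^ 2) \<phi> t y))
      + (4 * \<gamma> - 2 * \<beta>) *\<^sub>R commutator (\<phi> t y) (cubic t y))
    has_vector_derivative
      - \<alpha> *\<^sub>R (commutator (\<phi> t x) ((dx ^^ 2) \<phi> t x) + commutator (dx \<phi> t x) (dx \<phi> t x))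
      + \<beta> *\<^sub>R ((commutator (\<phi> t x) ((dx ^^ 4) \<phi> t x) + commutator (dx \<phi> t x) ((dx ^^ 3) \<phi> t x))
          - (commutator (dx \<phi> t x) ((dx ^^ 3) \<phi> t x)
             + commutator ((dx ^^ 2) \<phi> t x) ((dx ^^ 2) \<phi> t x)))
      + (4 * \<gamma> - 2 * \<beta>) *\<^sub>R
          (commutator (\<phi> t x) (dx cubic t x) + commutator (dx \<phi> t x) (cubic t x))) (at x)"
    using bil[OF D0 D1] bil[OF D0 D3] bil[OF D1 D2]
      bil[OF D0 smooth_has_dx[OF smooth_cubic t, of x]]
    by (intro has_vector_derivative_add has_vector_derivative_diff
        bounded_linear.has_vector_derivative[OF bounded_linear_scaleR_right])
      (simp_all add: eval_nat_numeral)
  moreover have "flux \<alpha> \<beta> \<gamma> \<phi> t = (\<lambda>y. - \<alpha> *\<^sub>R commutator (\<phi> t y) (dx \<phi> t y)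
      + \<beta> *\<^sub>R (commutator (\<phi> t y) ((dx ^^ 3) \<phi> t y) - commutator (dx \<phi> t y) ((dx ^^ 2) \<phi> t y))
      + (4 * \<gamma> - 2 * \<beta>) *\<^sub>R commutator (\<phi> t y) (cubic t y))"
    using flux_eq[OF t] by auto
  ultimately have "dx (flux \<alpha> \<beta> \<gamma> \<phi>) t x =
      - \<alpha> *\<^sub>R commutator (\<phi> t x) ((dx ^^ 2) \<phi> t x)
      + \<beta> *\<^sub>R commutator (\<phi> t x) ((dx ^^ 4) \<phi> t x)
      + (4 * \<gamma> - 2 * \<beta>) *\<^sub>R commutator (\<phi> t x) (dx cubic t x)"
    by (subst c0) (intro dxI, simp)
  moreover have "dx cubic t x = dx (\<lambda>s y. dx \<phi> s y ** matrix_inv (\<phi> s y) ** dx \<phi> s y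
                     ** matrix_inv (\<phi> s y) ** dx \<phi> s y) t x"
    by (rule dx_cong) (simp add: triple_product_eq_cubic[OF t])
  ultimately show ?thesis
    by (simp add: comm.add_right comm.diff_right comm.scaleR_right)
qed

lemma dx_mem_kernel:
  fixes L :: "'a^'n^'n \<Rightarrow> 'a^'n^'n"
  assumes L: "bounded_linear L" and f: "smooth_on_strip I f" and t: "t \<in> I"
    and 0: "\<And>y. L (f t y) = 0"
  shows "L (dx f t x) = 0"
proof -
  have "((\<lambda>y. 0) has_vector_derivative L (dx f t x)) (at x)"
    using bounded_linear.has_vector_derivative[OF L smooth_has_dx[OF f t], of x] by (simp add: 0)
  then show ?thesis
    using has_vector_derivative_const vector_derivative_unique_at by blast
qed

text \<open>
  Closure under cubes is needed because the cubic term of the flux is a multiple of \<open>\<phi>\<^sub>x\<^sup>3\<close>, which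
  is not a bracket.
\<close>

lemma flux_mem_kernel:
  fixes L :: "'a^'n^'n \<Rightarrow> 'a^'n^'n"
  assumes L: "bounded_linear L"
    and comm: "\<And>X Y. L X = 0 \<Longrightarrow> L Y = 0 \<Longrightarrow> L (commutator X Y) = 0"
    and cube: "\<And>X. L X = 0 \<Longrightarrow> L (X ** X ** X) = 0"
    and t: "t \<in> I" and \<phi>: "\<And>y. L (\<phi> t y) = 0"
  shows "L (flux \<alpha> \<beta> \<gamma> \<phi> t x) = 0"
proof -
  interpret L: bounded_linear L by (rule L)
  have D: "L ((dx ^^ n) \<phi> t y) = 0" for n y
    by (induction n arbitrary: y)
      (auto intro: \<phi> dx_mem_kernel[OF L smooth_on_strip_funpow_dx[OF smooth] t])
  from D[of 1 x] have D1: "L (dx \<phi> t x) = 0" by simp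
  show ?thesis
    by (simp add: flux_eq[OF t] L.add L.diff L.neg L.scaleR comm D D1 \<phi> cubic_def cube)
qed

end


section \<open>The correspondence for a general orbit\<close>

context
  fixes T :: ereal and G :: "('a::{real_normed_field,euclidean_space}^'n^'n) set"
    and A :: "'a^'n^'n" and c :: real
  assumes T: "0 < T" and G: "\<And>E. E \<in> G \<Longrightarrow> invertible E"
    and A: "A ** A = c *\<^sub>R mat 1" and c: "c \<noteq> 0"
begin

lemma scalar_square_flow_of_orbit:
  assumes "smooth_on_strip (time_interval T) \<phi>"
    and "\<And>t x. t \<in> time_interval T \<Longrightarrow> \<phi> t x \<in> orbit G A"
  shows "scalar_square_flow (time_interval T) c \<phi>"
  using assms strip_time_interval[OF T]
  by (auto simp: scalar_square_flow_def scalar_square_flow_axioms_def c intro: orbit_square[OF G A])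

lemma moving_imp_orbit_solution:
  assumes "moving_solution T \<alpha> \<beta> \<gamma> G A u"
  shows "orbit_solution T \<alpha> \<beta> \<gamma> G A (dx u)"
proof -
  let ?I = "time_interval T"
  from assms have u: "smooth_on_strip ?I u"
    and orb: "\<And>t x. t \<in> ?I \<Longrightarrow> dx u t x \<in> orbit G A"
    and eq: "\<And>t x. t \<in> ?I \<Longrightarrow> dt ?I u t x = flux \<alpha> \<beta> \<gamma> (dx u) t x"
    by (auto simp: moving_solution_iff_flux)
  interpret scalar_square_flow ?I c "dx u"
    by (rule scalar_square_flow_of_orbit[OF smooth_on_strip_dx[OF u] orb])
  have "dt ?I (dx u) t x = dx (flux \<alpha> \<beta> \<gamma> (dx u)) t x" if "t \<in> ?I" for t x
    unfolding dt_dx_commute[OF u that] by (rule dx_cong) (simp add: eq that)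
  then show ?thesis
    using smooth orb dx_flux by (simp add: orbit_solution_def)
qed

lemma orbit_imp_moving_solution:
  fixes L :: "'a^'n^'n \<Rightarrow> 'a^'n^'n"
  assumes L: "bounded_linear L" and lie: "lie_algebra G = {X. L X = 0}"
    and orbit: "\<And>X. X \<in> orbit G A \<Longrightarrow> L X = 0"
    and comm: "\<And>X Y. L X = 0 \<Longrightarrow> L Y = 0 \<Longrightarrow> L (commutator X Y) = 0"
    and cube: "\<And>X. L X = 0 \<Longrightarrow> L (X ** X ** X) = 0"
    and sol: "orbit_solution T \<alpha> \<beta> \<gamma> G A \<phi>"
  shows "\<exists>u. moving_solution T \<alpha> \<beta> \<gamma> G A u \<and> (\<forall>t\<in>time_interval T. \<forall>x. \<phi> t x = dx u t x)"
proof -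
  let ?I = "time_interval T" and ?F = "flux \<alpha> \<beta> \<gamma> \<phi>"
  interpret L: bounded_linear L by (rule L)
  from sol have \<phi>: "smooth_on_strip ?I \<phi>" and orb: "\<And>t x. t \<in> ?I \<Longrightarrow> \<phi> t x \<in> orbit G A"
    by (auto simp: orbit_solution_def)
  interpret scalar_square_flow ?I c \<phi>
    by (rule scalar_square_flow_of_orbit[OF \<phi> orb])
  have closed: "dt ?I \<phi> t x = dx ?F t x" if "t \<in> ?I" for t x
    using sol that by (simp add: orbit_solution_def dx_flux)
  define u where "u t x = radial_primitive (\<phi> t) x + radial_primitive (\<lambda>s. ?F s 0) t" for t x
  have u: "smooth_on_strip ?I u" "\<And>t x. t \<in> ?I \<Longrightarrow> dx u t x = \<phi> t x"
    "\<And>t x. t \<in> ?I \<Longrightarrow> dt ?I u t x = ?F t x"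
    unfolding u_def[abs_def] by (rule closed_form_potential[OF \<phi> smooth_flux]; simp add: closed)+
  have L0: "L (\<phi> t x) = 0" "L (?F t x) = 0" if "t \<in> ?I" for t x
    using that by (auto intro: orbit orb flux_mem_kernel[OF L comm cube])
  have "L (u t x) = 0" if t: "t \<in> ?I" for t x
  proof -
    have "L (radial_primitive (\<phi> t) x) = radial_primitive (\<lambda>y. L (\<phi> t y)) x"
      by (rule radial_primitive_bounded_linear[OF L, of UNIV])
        (use smooth_continuous_slice[OF \<phi> t] in auto)
    moreover have "continuous_on ?I (\<lambda>s. ?F s 0)"
      by (rule smooth_continuous_time_slice[OF smooth_flux])
    then have "L (radial_primitive (\<lambda>s. ?F s 0) t) = radial_primitive (\<lambda>s. L (?F s 0)) t"
      by (rule radial_primitive_bounded_linear[OF L convex_I zero_I t])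
    moreover have "integral {0..1} (\<lambda>r. L (?F (r * t) 0)) = integral {0..1} (\<lambda>r::real. 0)"
      by (rule integral_cong) (simp add: L0 convex_scale_mem[OF convex_I zero_I t])
    ultimately show ?thesis
      by (simp add: u_def L.add radial_primitive_def L0[OF t])
  qed
  moreover have "dx u t x = \<phi> t x" if "t \<in> ?I" for t x by (rule u(2)[OF that])
  moreover have "dt ?I u t x = flux \<alpha> \<beta> \<gamma> (dx u) t x" if t: "t \<in> ?I" for t x
    unfolding u(3)[OF t] by (rule flux_cong[OF _ t]) (simp add: u(2))
  ultimately have "moving_solution T \<alpha> \<beta> \<gamma> G A u"
    using u(1) orb by (simp add: moving_solution_iff_flux lie)
  then show ?thesis using u(2) by metis
qed

end


section \<open>The three symmetric Lie algebras\<close>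

lemma signature_matrix_diagonal:
  obtains s :: "'n::{finite,wellorder} \<Rightarrow> 'a::ring_1"
  where "\<And>i j. signature_matrix k $ i $ j = (if i = j then s i else 0)"
    and "\<And>i. s i = 1 \<or> s i = - 1"
  by (rule that[of "\<lambda>i. if card {l. l < i} < k then 1 else - 1"]) (auto simp: signature_matrix_def)

lemma signature_matrix_square:
  "signature_matrix k ** signature_matrix k = (mat 1 :: 'a::ring_1^'n::{finite,wellorder}^'n::{finite,wellorder})"
proof -
  let ?S = "signature_matrix k :: 'a^'n::{finite,wellorder}^'n::{finite,wellorder}"
  obtain s :: "'n \<Rightarrow> 'a" where s: "\<And>i j. ?S $ i $ j = (if i = j then s i else 0)"
    and pm: "\<And>i. s i = 1 \<or> s i = - 1"
    using signature_matrix_diagonal[of k] by blast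
  have "(\<Sum>l\<in>UNIV. ?S $ i $ l * ?S $ l $ j) = (if i = j then 1 else 0)" for i j :: 'n
  proof -
    have "(\<Sum>l\<in>UNIV. ?S $ i $ l * ?S $ l $ j) = (\<Sum>l\<in>UNIV. if l = i then s i * ?S $ i $ j else 0)"
      by (rule sum.cong) (simp_all add: s)
    also have "\<dots> = s i * ?S $ i $ j" by simp
    also have "\<dots> = (if i = j then 1 else 0)" using pm[of i] by (auto simp: s)
    finally show ?thesis .
  qed
  then show ?thesis by (simp add: vec_eq_iff matrix_matrix_mult_def mat_def)
qed

lemma conj_transpose_signature_matrix:
  "conj_transpose (signature_matrix k :: complex^'n::{finite,wellorder}^'n::{finite,wellorder}) = signature_matrix k"
proof -
  obtain s :: "'n \<Rightarrow> complex" where s: "\<And>i j. signature_matrix k $ i $ j = (if i = j then s i else 0)"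
    and pm: "\<And>i. s i = 1 \<or> s i = - 1"
    using signature_matrix_diagonal[of k] by blast
  have "cnj (s i) = s i" for i using pm[of i] by auto
  then show ?thesis by (simp add: vec_eq_iff conj_transpose_def s)
qed

lemma mat_mult_nth: "(mat a ** A) $ i $ j = a * A $ i $ j" for a :: "'a::semiring_1"
  by (simp add: matrix_matrix_mult_def mat_def if_distrib if_distribR cong: if_cong)

lemma mult_mat_nth: "(A ** mat a) $ i $ j = A $ i $ j * a" for a :: "'a::semiring_1"
  by (simp add: matrix_matrix_mult_def mat_def if_distrib if_distribR cong: if_cong)

lemma sigma3_complex_square:
  "sigma3_complex k ** sigma3_complex k = (- 1 / 4) *\<^sub>R (mat 1 :: complex^'n::{finite,wellorder}^'n::{finite,wellorder})"
proof -
  have s: "sigma3_complex k $ i $ j = (\<i> / 2) * signature_matrix k $ i $ j" for i j :: 'n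
    by (simp add: sigma3_complex_def mat_mult_nth)
  have "(sigma3_complex k ** sigma3_complex k) $ i $ j =
      (- 1 / 4) * (signature_matrix k ** signature_matrix k :: complex^'n::{finite,wellorder}^'n::{finite,wellorder}) $ i $ j" for i j :: 'n
    by (simp add: matrix_matrix_mult_def s sum_distrib_left field_simps sum_divide_distrib sum_negf)
  then show ?thesis
    by (simp add: signature_matrix_square vec_eq_iff mat_def complex_eq_iff)
qed

lemma sigma3_real_square:
  "sigma3_real k ** sigma3_real k = (1 / 4) *\<^sub>R (mat 1 :: real^'n::{finite,wellorder}^'n::{finite,wellorder})"
proof -
  have s: "sigma3_real k $ i $ j = (1 / 2) * signature_matrix k $ i $ j" for i j :: 'n
    by (simp add: sigma3_real_def mat_mult_nth)
  have "(sigma3_real k ** sigma3_real k) $ i $ j =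
      (1 / 4) * (signature_matrix k ** signature_matrix k :: real^'n::{finite,wellorder}^'n::{finite,wellorder}) $ i $ j" for i j :: 'n
    by (simp add: matrix_matrix_mult_def s sum_distrib_left field_simps sum_divide_distrib)
  then show ?thesis
    by (simp add: signature_matrix_square vec_eq_iff mat_def)
qed

lemma conj_transpose_sigma3_complex:
  "conj_transpose (sigma3_complex k :: complex^'n::{finite,wellorder}^'n::{finite,wellorder}) = - sigma3_complex k"
proof -
  have "cnj (signature_matrix k $ j $ i) = signature_matrix k $ i $ j" for i j :: 'n
    using conj_transpose_signature_matrix[where 'n = 'n, of k]
    by (simp add: conj_transpose_def vec_eq_iff)
  then show ?thesis
    by (simp add: vec_eq_iff conj_transpose_def sigma3_complex_def mat_mult_nth)
qed

lemma sigma3_complex_signature_commute: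
  "sigma3_complex k ** signature_matrix k = signature_matrix k ** (sigma3_complex k :: complex^'n::{finite,wellorder}^'n::{finite,wellorder})"
proof -
  have "mat (\<i> / 2) ** signature_matrix k = (signature_matrix k ** mat (\<i> / 2) :: complex^'n::{finite,wellorder}^'n::{finite,wellorder})"
    by (simp add: vec_eq_iff mat_mult_nth mult_mat_nth mult.commute)
  then show ?thesis unfolding sigma3_complex_def by (metis matrix_mul_assoc)
qed

text \<open>
  The equation \<open>form_defect J X = 0\<close> is the linearization at the identity of \<open>E\<^sup>* J E = J\<close>. Its
  solutions form \<open>u(n)\<close> for \<open>J = I\<close> and \<open>u(k, n - k)\<close> for the signature matrix \<open>J\<close>.
\<close>

definition form_defect :: "complex^'n^'n \<Rightarrow> complex^'n^'n \<Rightarrow> complex^'n^'n"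
  where "form_defect J X = conj_transpose X ** J + J ** X"

context
  fixes J :: "complex^'n::{finite,wellorder}^'n::{finite,wellorder}" and k :: nat
  assumes J_square: "J ** J = mat 1"
    and J_sigma3: "sigma3_complex k ** J = J ** sigma3_complex k"
begin

lemma form_group_inverse:
  assumes "conj_transpose E ** J ** E = J"
  shows "invertible E" and "conj_transpose E ** J = J ** matrix_inv E"
proof -
  have "J ** conj_transpose E ** J ** E = mat 1"
    using assms J_square by (metis matrix_mul_assoc)
  then show inv: "invertible E"
    unfolding invertible_def using matrix_left_right_inverse by blast
  have "conj_transpose E ** J ** (E ** matrix_inv E) = J ** matrix_inv E"
    using assms by (simp add: matrix_mul_assoc)
  then show "conj_transpose E ** J = J ** matrix_inv E"
    by (simp add: matrix_inv_right[OF inv])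
qed

lemma bounded_linear_form_defect: "bounded_linear (form_defect J)"
  unfolding form_defect_def[abs_def]
  by (intro bounded_linear_add bounded_linear_compose[OF bounded_bilinear.bounded_linear_left[OF
          bounded_bilinear_matrix_mult] bounded_linear_conj_transpose]
      bounded_bilinear.bounded_linear_right[OF bounded_bilinear_matrix_mult])

lemma form_defect_eq_0: "form_defect J X = 0 \<longleftrightarrow> conj_transpose X ** J = - (J ** X)"
  by (simp add: form_defect_def eq_neg_iff_add_eq_0)

text \<open>
  The map \<open>X \<mapsto> E\<inverse> X E\<close> preserves the Lie algebra when \<open>E\<close> preserves \<open>J\<close>, and \<open>\<sigma>\<^sub>3\<close> itself lies in it,
  being skew-Hermitian and commuting with \<open>J\<close>.
\<close>

lemma form_defect_orbit:
  assumes "X \<in> orbit {E. conj_transpose E ** J ** E = J} (sigma3_complex k)"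
  shows "form_defect J X = 0"
proof -
  interpret mm: bounded_bilinear "(**) :: (complex^'n::{finite,wellorder}^'n::{finite,wellorder}) \<Rightarrow> complex^'n::{finite,wellorder}^'n::{finite,wellorder} \<Rightarrow> complex^'n::{finite,wellorder}^'n::{finite,wellorder}"
    by (rule bounded_bilinear_matrix_mult)
  let ?s = "sigma3_complex k :: complex^'n::{finite,wellorder}^'n::{finite,wellorder}"
  obtain E where E: "conj_transpose E ** J ** E = J" and X: "X = matrix_inv E ** ?s ** E"
    using assms by (auto simp: orbit_def)
  note inv = form_group_inverse[OF E]
  have "conj_transpose (matrix_inv E) ** (conj_transpose E ** J) = J"
    by (metis matrix_mul_assoc conj_transpose_mult matrix_inv_right[OF inv(1)] conj_transpose_mat_1
        matrix_mul_lid)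
  then have "conj_transpose (matrix_inv E) ** J = conj_transpose (matrix_inv E) ** (conj_transpose E ** J) ** E"
    using E by (metis matrix_mul_assoc)
  also have "\<dots> = J ** E"
    using \<open>conj_transpose (matrix_inv E) ** (conj_transpose E ** J) = J\<close> by simp
  finally have "conj_transpose X ** J = - (conj_transpose E ** ?s ** (J ** E))"
    by (simp add: X conj_transpose_mult conj_transpose_sigma3_complex mm.minus_left mm.minus_right
        flip: matrix_mul_assoc)
  also have "\<dots> = - (conj_transpose E ** (?s ** J) ** E)"
    by (simp add: matrix_mul_assoc)
  also have "\<dots> = - ((conj_transpose E ** J) ** ?s ** E)"
    by (simp add: J_sigma3 matrix_mul_assoc)
  also have "\<dots> = - (J ** X)"
    by (simp add: inv(2) X matrix_mul_assoc)
  finally show ?thesis by (simp add: form_defect_eq_0)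
qed

text \<open>
  Two transpositions past \<open>J\<close> cancel their signs but reverse the order of the factors:
  \<open>(P Q)\<^sup>* J = J (Q P)\<close>. So the bracket changes its sign.
\<close>

lemma form_defect_commutator:
  assumes "form_defect J X = 0" "form_defect J Y = 0"
  shows "form_defect J (commutator X Y) = 0"
proof -
  interpret mm: bounded_bilinear "(**) :: (complex^'n::{finite,wellorder}^'n::{finite,wellorder}) \<Rightarrow> complex^'n::{finite,wellorder}^'n::{finite,wellorder} \<Rightarrow> complex^'n::{finite,wellorder}^'n::{finite,wellorder}"
    by (rule bounded_bilinear_matrix_mult)
  interpret ct: bounded_linear "conj_transpose :: complex^'n::{finite,wellorder}^'n::{finite,wellorder} \<Rightarrow> complex^'n::{finite,wellorder}^'n::{finite,wellorder}"
    by (rule bounded_linear_conj_transpose)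
  have *: "conj_transpose (P ** Q) ** J = J ** (Q ** P)"
    if P: "conj_transpose P ** J = - (J ** P)" and Q: "conj_transpose Q ** J = - (J ** Q)" for P Q
  proof -
    have "conj_transpose (P ** Q) ** J = conj_transpose Q ** (conj_transpose P ** J)"
      by (simp add: conj_transpose_mult matrix_mul_assoc)
    also have "\<dots> = - ((conj_transpose Q ** J) ** P)"
      by (simp add: P mm.minus_right matrix_mul_assoc)
    also have "\<dots> = J ** (Q ** P)" by (simp add: Q mm.minus_left matrix_mul_assoc)
    finally show ?thesis .
  qed
  show ?thesis
    using assms unfolding form_defect_eq_0
    by (simp add: commutator_def ct.diff mm.diff_left mm.diff_right *)
qed

text \<open>
  Each of the three factors contributes a sign when it is moved past \<open>J\<close>, and reversing the order of
  equal factors changes nothing.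
\<close>

lemma form_defect_cube:
  assumes "form_defect J X = 0"
  shows "form_defect J (X ** X ** X) = 0"
proof -
  interpret mm: bounded_bilinear "(**) :: (complex^'n::{finite,wellorder}^'n::{finite,wellorder}) \<Rightarrow> complex^'n::{finite,wellorder}^'n::{finite,wellorder} \<Rightarrow> complex^'n::{finite,wellorder}^'n::{finite,wellorder}"
    by (rule bounded_bilinear_matrix_mult)
  let ?X = "conj_transpose X"
  have X: "?X ** J = - (J ** X)" using assms by (simp add: form_defect_eq_0)
  have "conj_transpose (X ** X ** X) ** J = ?X ** (?X ** (?X ** J))"
    by (simp add: conj_transpose_mult matrix_mul_assoc)
  also have "\<dots> = - (?X ** ((?X ** J) ** X))"
    by (simp add: X mm.minus_right matrix_mul_assoc)
  also have "\<dots> = (?X ** J) ** X ** X"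
    by (simp add: X mm.minus_right mm.minus_left matrix_mul_assoc)
  also have "\<dots> = - (J ** (X ** X ** X))"
    by (simp add: X mm.minus_left matrix_mul_assoc)
  finally show ?thesis by (simp add: form_defect_eq_0)
qed

lemma form_group_correspondence:
  assumes T: "0 < T" and G: "G = {E. conj_transpose E ** J ** E = J}"
  shows "(\<forall>u. moving_solution T \<alpha> \<beta> \<gamma> G (sigma3_complex k) u \<longrightarrow>
             orbit_solution T \<alpha> \<beta> \<gamma> G (sigma3_complex k) (dx u)) \<and>
        (\<forall>\<phi>. orbit_solution T \<alpha> \<beta> \<gamma> G (sigma3_complex k) \<phi> \<longrightarrow>
             (\<exists>u. moving_solution T \<alpha> \<beta> \<gamma> G (sigma3_complex k) u \<and>
                  (\<forall>t\<in>time_interval T. \<forall>x. \<phi> t x = dx u t x)))"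
proof -
  have inv: "\<And>E. E \<in> G \<Longrightarrow> invertible E" using G form_group_inverse(1) by blast
  have c: "- 1 / 4 \<noteq> (0::real)" by simp
  show ?thesis
  proof (intro conjI allI impI)
    fix u assume "moving_solution T \<alpha> \<beta> \<gamma> G (sigma3_complex k) u"
    then show "orbit_solution T \<alpha> \<beta> \<gamma> G (sigma3_complex k) (dx u)"
      using moving_imp_orbit_solution[OF T inv sigma3_complex_square c] by blast
  next
    fix \<phi> assume \<phi>: "orbit_solution T \<alpha> \<beta> \<gamma> G (sigma3_complex k) \<phi>"
    have lie: "lie_algebra G = {X. form_defect J X = 0}"
      by (simp add: G form_defect_def lie_algebra_form)
    show "\<exists>u. moving_solution T \<alpha> \<beta> \<gamma> G (sigma3_complex k) u \<and>
        (\<forall>t\<in>time_interval T. \<forall>x. \<phi> t x = dx u t x)"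
      by (rule orbit_imp_moving_solution[OF T _ sigma3_complex_square c bounded_linear_form_defect
            lie _ _ _ \<phi>])
        (use inv form_defect_orbit[folded G] form_defect_commutator form_defect_cube in blast)+
  qed
qed

end

theorem theorem2:
  fixes T :: ereal and \<alpha> \<beta> \<gamma> :: real and k :: nat
  assumes "0 < T"
    and "1 \<le> k" and "k < CARD('n::{finite,wellorder})"
  shows
    "(\<forall>G \<in> {unitary_group, pseudo_unitary_group k} :: (complex^'n::{finite,wellorder}^'n::{finite,wellorder}) set set.
        (\<forall>u. moving_solution T \<alpha> \<beta> \<gamma> G (sigma3_complex k) u \<longrightarrow>
             orbit_solution T \<alpha> \<beta> \<gamma> G (sigma3_complex k) (dx u)) \<and>
        (\<forall>\<phi>. orbit_solution T \<alpha> \<beta> \<gamma> G (sigma3_complex k) \<phi> \<longrightarrow>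
             (\<exists>u. moving_solution T \<alpha> \<beta> \<gamma> G (sigma3_complex k) u \<and>
                  (\<forall>t\<in>time_interval T. \<forall>x. \<phi> t x = dx u t x)))) \<and>
     (\<forall>u. moving_solution T \<alpha> \<beta> \<gamma> (general_linear_group :: (real^'n::{finite,wellorder}^'n::{finite,wellorder}) set) (sigma3_real k) u \<longrightarrow>
          orbit_solution T \<alpha> \<beta> \<gamma> general_linear_group (sigma3_real k) (dx u)) \<and>
     (\<forall>\<phi>. orbit_solution T \<alpha> \<beta> \<gamma> (general_linear_group :: (real^'n::{finite,wellorder}^'n::{finite,wellorder}) set) (sigma3_real k) \<phi> \<longrightarrow>
          (\<exists>u. moving_solution T \<alpha> \<beta> \<gamma> general_linear_group (sigma3_real k) u \<and>
               (\<forall>t\<in>time_interval T. \<forall>x. \<phi> t x = dx u t x)))"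
proof -
  have unitary: "unitary_group = {E :: complex^'n::{finite,wellorder}^'n::{finite,wellorder}. conj_transpose E ** mat 1 ** E = mat 1}"
    by (simp add: unitary_group_def)
  \<comment> \<open>The Lie algebra \<open>gl(n, \<real>)\<close> consists of all real matrices and is the kernel of \<open>L = 0\<close>.\<close>
  have real_orbit: "moving_solution T \<alpha> \<beta> \<gamma> general_linear_group (sigma3_real k :: real^'n::{finite,wellorder}^'n::{finite,wellorder}) u \<Longrightarrow>
      orbit_solution T \<alpha> \<beta> \<gamma> general_linear_group (sigma3_real k) (dx u)" for u
    by (rule moving_imp_orbit_solution[OF assms(1) _ sigma3_real_square])
      (simp_all add: general_linear_group_def)
  have real_moving: "orbit_solution T \<alpha> \<beta> \<gamma> general_linear_group (sigma3_real k :: real^'n::{finite,wellorder}^'n::{finite,wellorder}) \<phi> \<Longrightarrow>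
      \<exists>u. moving_solution T \<alpha> \<beta> \<gamma> general_linear_group (sigma3_real k) u \<and>
        (\<forall>t\<in>time_interval T. \<forall>x. \<phi> t x = dx u t x)" for \<phi>
    by (rule orbit_imp_moving_solution[OF assms(1) _ sigma3_real_square _ bounded_linear_zero])
      (simp_all add: general_linear_group_def lie_algebra_general_linear[unfolded general_linear_group_def])
  show ?thesis
    using form_group_correspondence[OF _ _ assms(1) unitary, of k \<alpha> \<beta> \<gamma>]
      form_group_correspondence[OF signature_matrix_square sigma3_complex_signature_commute assms(1)
        pseudo_unitary_group_def, of \<alpha> \<beta> \<gamma>]
      real_orbit real_moving
    by simp
qed

end
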